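(* Let $X$ be a separable Banach space and let $f:X\to\mathbb{R}$ be quasiconvex and densely continuous. With $m:=\mathcal{T}\operatorname{ess\,inf}_X f$, suppose that $F_m$ is nowhere dense. Then $f$ is Hadamard differentiable on an open and dense subset of $X$ except at the points of an Aronszajn null set. In particular, if $F'_m$ is contained in an Aronszajn null (resp. Haar null) set, or if $F'_m$ is of second category and $\overline{F_m}$ is Aronszajn null (resp. Haar null), then $f$ is Hadamard differentiable on $X$ except at the points of an Aronszajn null (resp. Haar null) set.
   Context: Banach spaces are real. A function $f:X\to\mathbb{R}$ is quasiconvex if $f(\lambda x+(1-\lambda)y)\le\max\{f(x),f(y)\}$ for all $x,y\in X$ and $\lambda\in[0,1]$. It is densely continuous if it is continuous at the points of a dense subset of $X$. For $\alpha\in\mathbb{R}\cup\{-\infty\}$, $F_\alpha:=\{x\in X:f(x)<\alpha\}$ and $F'_\alpha:=\{x\in X:f(x)\le\alpha\}$ (both empty for $\alpha=-\infty$). First category means a countable union of nowhere dense subsets of $X$; second category means not of first category. The topological essential infimum is $\mathcal{T}\operatorname{ess\,inf}_X f:=\sup\{\alpha\in\mathbb{R}:F_\alpha\text{ is of first category}\}=\inf\{\alpha\in\mathbb{R}:F_\alpha\text{ is of second category}\}\in[-\infty,\infty)$. $f$ is Gâteaux differentiable at $x$ with derivative $Df(x)\in X^*$ if $Df(x)h=\lim_{t\to0}\frac{f(x+th)-f(x)}{t}$ for every $h\in X$; it is Hadamard differentiable at $x$ if moreover the limit is uniform for $h$ in every compact subset of $X$. A Borel set $E\subset X$ is Aronszajn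 null if for every sequence $(\xi_n)\subset X$ with $\overline{\operatorname{span}}\{\xi_n\}=X$ one can write $E=\bigcup_nE_n$ with $E_n$ Borel and, for every $x\in X$, $\lambda_1((x+\mathbb{R}\xi_n)\cap E_n)=0$ ($\lambda_1$ = one-dimensional Lebesgue measure). A Borel set $E\subset X$ is Haar null if there is a Borel probability measure $\mu$ on $X$ with $\mu(x+E)=0$ for every $x\in X$. "A property holds on $S$ except at the points of an Aronszajn (Haar) null set" means that there is an Aronszajn (Haar) null set $N$ such that the property holds at every point of $S\setminus N$. *)

theory Defs
  imports "HOL-Analysis.Analysis" "HOL-Probability.Probability_Measure"
begin

definition quasiconvex :: "('a::real_vector \<Rightarrow> real) \<Rightarrow> bool" where
  "quasiconvex f \<longleftrightarrow>
    (\<forall>x y. \<forall>l\<in>{0..1}. f (l *\<^sub>R x + (1 - l) *\<^sub>R y) \<le> max (f x) (f y))"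

definition densely_continuous :: "('a::t2_space \<Rightarrow> real) \<Rightarrow> bool" where
  "densely_continuous f \<longleftrightarrow> (\<exists>D. closure D = UNIV \<and> (\<forall>x\<in>D. isCont f x))"

definition nowhere_dense :: "'a::topological_space set \<Rightarrow> bool" where
  "nowhere_dense S \<longleftrightarrow> interior (closure S) = {}"

definition first_category :: "'a::topological_space set \<Rightarrow> bool" where
  "first_category S \<longleftrightarrow> (\<exists>A :: nat \<Rightarrow> 'a set. (\<forall>n. nowhere_dense (A n)) \<and> S = (\<Union>n. A n))"

abbreviation second_category :: "'a::topological_space set \<Rightarrow> bool" where
  "second_category S \<equiv> \<not> first_category S"

text \<open>The levels are extended reals, since the essential infimum below may be \<open>-\<infinity>\<close>;
  at that level both sets are empty.\<close>

definition strict_sublevel :: "('a \<Rightarrow> real) \<Rightarrow> ereal \<Rightarrow> 'a set" where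
  "strict_sublevel f \<alpha> = {x. ereal (f x) < \<alpha>}"

definition sublevel :: "('a \<Rightarrow> real) \<Rightarrow> ereal \<Rightarrow> 'a set" where
  "sublevel f \<alpha> = {x. ereal (f x) \<le> \<alpha>}"

definition top_ess_inf :: "('a::topological_space \<Rightarrow> real) \<Rightarrow> ereal" where
  "top_ess_inf f = (SUP \<alpha>\<in>{\<alpha>::real. first_category (strict_sublevel f (ereal \<alpha>))}. ereal \<alpha>)"

definition has_gateaux_derivative ::
    "('a::real_normed_vector \<Rightarrow> real) \<Rightarrow> ('a \<Rightarrow> real) \<Rightarrow> 'a \<Rightarrow> bool" where
  "has_gateaux_derivative f D x \<longleftrightarrow> bounded_linear D \<and>
    (\<forall>h. ((\<lambda>t::real. (f (x + t *\<^sub>R h) - f x) / t) \<longlongrightarrow> D h) (at 0))"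

definition hadamard_differentiable_at ::
    "('a::real_normed_vector \<Rightarrow> real) \<Rightarrow> 'a \<Rightarrow> bool" where
  "hadamard_differentiable_at f x \<longleftrightarrow>
    (\<exists>D. has_gateaux_derivative f D x \<and>
      (\<forall>K. compact K \<longrightarrow>
        uniform_limit K (\<lambda>(t::real) h. (f (x + t *\<^sub>R h) - f x) / t) D (at 0)))"

text \<open>For \<open>\<xi> n \<noteq> 0\<close>, the trace of \<open>E n\<close> on the line \<open>x + \<real> \<xi> n\<close> is measured through the
  parametrization \<open>t \<mapsto> x + t \<xi> n\<close>, which rescales one-dimensional Lebesgue measure by
  the positive factor \<open>norm (\<xi> n)\<close>.  For \<open>\<xi> n = 0\<close> the line is a single point, of
  one-dimensional measure 0, so no condition arises.\<close>

definition aronszajn_null :: "'a::real_normed_vector set \<Rightarrow> bool" where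
  "aronszajn_null E \<longleftrightarrow> E \<in> sets borel \<and>
    (\<forall>\<xi> :: nat \<Rightarrow> 'a. closure (span (range \<xi>)) = UNIV \<longrightarrow>
      (\<exists>A :: nat \<Rightarrow> 'a set. E = (\<Union>n. A n) \<and>
        (\<forall>n. A n \<in> sets borel \<and>
          (\<xi> n \<noteq> 0 \<longrightarrow> (\<forall>x. {t::real. x + t *\<^sub>R \<xi> n \<in> A n} \<in> null_sets lborel)))))"

definition haar_null :: "'a::real_normed_vector set \<Rightarrow> bool" where
  "haar_null E \<longleftrightarrow> E \<in> sets borel \<and>
    (\<exists>\<mu> :: 'a measure. sets \<mu> = sets borel \<and> prob_space \<mu> \<and>
      (\<forall>x. emeasure \<mu> ((\<lambda>y. x + y) ` E) = 0))"

definition holds_except_null ::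
    "('a set \<Rightarrow> bool) \<Rightarrow> 'a set \<Rightarrow> ('a \<Rightarrow> bool) \<Rightarrow> bool" where
  "holds_except_null null S P \<longleftrightarrow> (\<exists>N. null N \<and> (\<forall>x\<in>S - N. P x))"

end

theory Submission
  imports Defs "HOL-Probability.Infinite_Product_Measure"
begin

text \<open>
  A quasiconvex function is, away from its lowest level, monotone along a cone.  Let \<open>\<beta>\<close> be a real
  number above the essential infimum \<open>m\<close>.  The convex set of points with \<open>f < \<beta>\<close> is of second category,
  and dense continuity makes it contain a ball around some \<open>z\<close>.  If \<open>x\<close> lies off the closure of
  this set, then near \<open>x\<close> the function increases in all directions close to \<open>x - z\<close>: a decrease would
  contradict quasiconvexity on a segment that starts in the ball.  If \<open>f x > \<beta>\<close> but \<open>x\<close> lies in the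
  closure, then \<open>x\<close> is on the frontier of a convex set with interior points.  So up to
  countably many such frontiers, which are null by the same monotonicity, all points
  outside the sublevel set \<open>F'\<close> at height \<open>m\<close> are points of local monotonicity
  (\<open>quasiconvex_hadamard_above_ess_inf\<close>).

  Where \<open>f\<close> is monotone along a cone, its oscillation near a point is controlled by its oscillation
  along one line whose direction is interior to the cone.  A monotone function of one variable
  is pointwise Lipschitz almost everywhere, so the points where \<open>f\<close> is not pointwise Lipschitz
  are null on all lines in that direction
  (\<open>cone_monotone_pointwise_lipschitz_off_null\<close>).  Stepanov's theorem then gives
  differentiability (\<open>stepanov_hadamard\<close>): locally \<open>f\<close> is squeezed between two Lipschitz functions
  that touch it, and Lipschitz functions are Gateaux differentiable off a null set
  (\<open>lipschitz_gateaux_differentiable_off_null\<close>); for them Gateaux and Hadamard differentiability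
  coincide.

  Two observations keep everything on lines.  First, a set that is null on all lines in direction
  \<open>h\<close> splits along the vectors of a given sequence as soon as \<open>h\<close> is in their linear span
  (\<open>decomposes_along_of_null_along_span\<close>).  Second, additivity of existing directional derivatives
  can fail only at countably many points of each line in one of the two directions
  (\<open>null_along_not_additive_derivative\<close>).

  It remains to treat \<open>F'\<close>.  If \<open>F'\<close> is nowhere dense, the complement of its closure is the
  required open dense set.  Otherwise \<open>F'\<close> has interior points, its frontier is null, and \<open>f\<close> is constant near
  each point of its interior that is off the closure of the strict sublevel set at
  height \<open>m\<close>; the complement of this closure is then the required set
  (\<open>quasiconvex_hadamard_minimal_level\<close>).  For the statements about Haar null sets, the null sets
  above are Haar null, by a random series, and Haar null sets are closed under unions, by
  convolution.
\<close>

section \<open>Monotone and Lipschitz functions of one real variable\<close>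

text \<open>
  Vitali's covering theorem selects countably many disjoint intervals of slope at least \<open>q\<close> that
  cover \<open>E\<close> up to a null set; \<open>B\<close> is their union.  Since \<open>g\<close> is monotone, the increments of \<open>g\<close>
  over them are the lengths of disjoint intervals between \<open>g c\<close> and \<open>g d\<close>.
\<close>

lemma vitali_increment:
  fixes g :: "real \<Rightarrow> real"
  assumes mono: "mono_on {c..d} g" and "c \<le> d" "0 \<le> q" and E: "E \<subseteq> {c<..<d}"
    and steep: "\<And>x e. \<lbrakk>x \<in> E; 0 < e\<rbrakk> \<Longrightarrow>
      \<exists>u v. u \<le> x \<and> x \<le> v \<and> u < v \<and> v - u < e \<and> q * (v - u) \<le> g v - g u"
  shows "\<exists>B. B \<in> sets borel \<and> negligible (E - B) \<and>
    ennreal q * emeasure lborel B \<le> ennreal (g d - g c)"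
proof -
  let ?K = "{p. c \<le> fst p \<and> fst p < snd p \<and> snd p \<le> d \<and> q * (snd p - fst p) \<le> g (snd p) - g (fst p)}"
  let ?a = "\<lambda>p. (fst p + snd p) / 2 :: real" and ?r = "\<lambda>p. (snd p - fst p) / 2 :: real"
  have ball: "cball (?a p) (?r p) = {fst p..snd p}" for p :: "real \<times> real"
    by (simp add: cball_eq_atLeastAtMost field_simps)
  have cover: "\<exists>p. p \<in> ?K \<and> x \<in> cball (?a p) (?r p) \<and> ?r p < e" if x: "x \<in> E" "0 < e" for x e
  proof -
    have "c < x" "x < d" using E that by auto
    then have "0 < min e (min (x - c) (d - x))" using that by auto
    then obtain u v where uv: "u \<le> x" "x \<le> v" "u < v" "v - u < min e (min (x - c) (d - x))"
      "q * (v - u) \<le> g v - g u"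
      using steep[OF x(1)] by blast
    then have "(u, v) \<in> ?K" by auto
    then show ?thesis
      using uv unfolding ball by (intro exI[of _ "(u, v)"]) simp
  qed
  obtain C where C: "countable C" "C \<subseteq> ?K"
     "pairwise (\<lambda>i j. disjnt (cball (?a i) (?r i)) (cball (?a j) (?r j))) C"
     "negligible (E - (\<Union>i \<in> C. cball (?a i) (?r i)))"
    by (rule Vitali_covering_theorem_cballs[of ?K ?r E ?a, OF _ cover]) auto
  let ?B = "\<Union>p\<in>C. {fst p..snd p}"
  have disj: "{fst p..snd p} \<inter> {fst p'..snd p'} = {}" if "p \<in> C" "p' \<in> C" "p \<noteq> p'" for p p'
    using C(3) that unfolding pairwise_def disjnt_def ball by blast
  have g_le: "g s \<le> g t" if "c \<le> s" "s \<le> t" "t \<le> d" for s t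
    using mono that by (auto simp: mono_on_def)
  \<comment> \<open>Monotonicity turns disjoint intervals into disjoint image intervals.\<close>
  have disj_img: "{g (fst p)<..<g (snd p)} \<inter> {g (fst p')<..<g (snd p')} = {}"
    if "p \<in> C" "p' \<in> C" "p \<noteq> p'" for p p'
  proof -
    have K: "p \<in> ?K" "p' \<in> ?K" using C(2) that by auto
    have "snd p < fst p' \<or> snd p' < fst p"
    proof (rule ccontr)
      assume "\<not> ?thesis"
      then have "max (fst p) (fst p') \<in> {fst p..snd p} \<inter> {fst p'..snd p'}" using K by auto
      then show False using disj[OF that] by blast
    qed
    then have "g (snd p) \<le> g (fst p') \<or> g (snd p') \<le> g (fst p)"
      using K by (auto intro!: g_le)
    then show ?thesis by auto
  qed
  have "ennreal q * emeasure lborel ?B = (\<integral>\<^sup>+p. ennreal q * emeasure lborel {fst p..snd p} \<partial>count_space C)"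
    using C(1) disj
    by (subst emeasure_UN_countable) (auto simp: disjoint_family_on_def nn_integral_cmult)
  also have "\<dots> \<le> (\<integral>\<^sup>+p. emeasure lborel {g (fst p)<..<g (snd p)} \<partial>count_space C)"
  proof (rule nn_integral_mono)
    fix p assume "p \<in> space (count_space C)"
    then have p: "p \<in> ?K" using C(2) by auto
    then have "g (fst p) \<le> g (snd p)" by (auto intro!: g_le)
    then show "ennreal q * emeasure lborel {fst p..snd p} \<le> emeasure lborel {g (fst p)<..<g (snd p)}"
      using p \<open>0 \<le> q\<close> by (auto simp: ennreal_mult'[symmetric] intro!: ennreal_leI)
  qed
  also have "\<dots> = emeasure lborel (\<Union>p\<in>C. {g (fst p)<..<g (snd p)})"
    using C(1) disj_img
    by (subst emeasure_UN_countable) (auto simp: disjoint_family_on_def)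
  also have "\<dots> \<le> emeasure lborel {g c..g d}"
  proof (rule emeasure_mono)
    show "(\<Union>p\<in>C. {g (fst p)<..<g (snd p)}) \<subseteq> {g c..g d}"
    proof safe
      fix p1 p2 x assume p: "(p1, p2) \<in> C" and x: "x \<in> {g (fst (p1, p2))<..<g (snd (p1, p2))}"
      have "g c \<le> g p1" "g p2 \<le> g d" using p C(2) by (auto intro!: g_le)
      then show "x \<in> {g c..g d}" using x by auto
    qed
  qed auto
  also have "\<dots> = ennreal (g d - g c)"
    using g_le[of c d] \<open>c \<le> d\<close> by simp
  finally show ?thesis
    using C(1,4) by (intro exI[of _ ?B]) (auto simp: ball)
qed

text \<open>
  One index bounds both the Lipschitz constant and the radius: this exhausts all pairs of a
  constant and a radius by countably many sets, each of which is closed whatever \<open>f\<close> is.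
\<close>

definition lip_points :: "('a::metric_space \<Rightarrow> real) \<Rightarrow> nat \<Rightarrow> 'a set" where
  "lip_points f n = {x. \<forall>y. dist y x < 1 / real (Suc n) \<longrightarrow> \<bar>f y - f x\<bar> \<le> real (Suc n) * dist y x}"

definition pointwise_lipschitz_set :: "('a::metric_space \<Rightarrow> real) \<Rightarrow> 'a set" where
  "pointwise_lipschitz_set f = (\<Union>n. lip_points f n)"

lemma pointwise_lipschitz_setI:
  assumes "0 < e" "\<And>y. dist y x < e \<Longrightarrow> \<bar>f y - f x\<bar> \<le> L * dist y x"
  shows "x \<in> pointwise_lipschitz_set f"
proof -
  obtain n where n: "max L (1 / e) < real n" using reals_Archimedean2 by blast
  have "\<bar>f y - f x\<bar> \<le> real (Suc n) * dist y x" if "dist y x < 1 / real (Suc n)" for y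
  proof -
    have "1 / real (Suc n) < e" using n \<open>0 < e\<close> by (simp add: field_simps)
    then have "\<bar>f y - f x\<bar> \<le> L * dist y x" using assms(2) that by auto
    also have "\<dots> \<le> real (Suc n) * dist y x" using n by (intro mult_right_mono) auto
    finally show ?thesis .
  qed
  then show ?thesis by (auto simp: pointwise_lipschitz_set_def lip_points_def)
qed

text \<open>
  At a point of the exceptional set there are, for every \<open>n\<close>, arbitrarily short intervals of slope
  at least \<open>n\<close>, so the set is covered, up to a null set, by a set of measure at most
  \<open>(g d - g c) / n\<close>.
\<close>

lemma negligible_not_pointwise_lipschitz_mono:
  fixes g :: "real \<Rightarrow> real"
  assumes mono: "mono_on {c..d} g"
  shows "negligible ({c<..<d} - pointwise_lipschitz_set g)"
proof (cases "c \<le> d")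
  case True
  let ?E = "{c<..<d} - pointwise_lipschitz_set g"
  have "\<forall>n. \<exists>B. B \<in> sets borel \<and> negligible (?E - B) \<and> ennreal (real n) * emeasure lborel B \<le> ennreal (g d - g c)"
  proof
    fix n :: nat
    have steep: "\<exists>u v. u \<le> x \<and> x \<le> v \<and> u < v \<and> v - u < e \<and> real n * (v - u) \<le> g v - g u"
      if x: "x \<in> ?E" and e: "0 < e" for x e
    proof -
      define e' where "e' = min e (min (x - c) (d - x))"
      have e': "0 < e'" "e' \<le> e" "e' \<le> x - c" "e' \<le> d - x" using x e by (auto simp: e'_def)
      obtain y where y: "dist y x < e'" "\<bar>g y - g x\<bar> > real n * dist y x"
        using pointwise_lipschitz_setI[of e' x g "real n"] x e' by force
      have mem: "x \<in> {c..d}" "y \<in> {c..d}" using x y e' by (auto simp: dist_real_def)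
      have "y \<noteq> x" using y by auto
      then consider "y < x" | "x < y" by linarith
      then show ?thesis
      proof cases
        case 1
        then have "g y \<le> g x" using mono mem by (auto simp: mono_on_def)
        then show ?thesis using 1 y e' by (intro exI[of _ y] exI[of _ x]) (auto simp: dist_real_def)
      next
        case 2
        then have "g x \<le> g y" using mono mem by (auto simp: mono_on_def)
        then show ?thesis using 2 y e' by (intro exI[of _ x] exI[of _ y]) (auto simp: dist_real_def)
      qed
    qed
    show "\<exists>B. B \<in> sets borel \<and> negligible (?E - B) \<and>
      ennreal (real n) * emeasure lborel B \<le> ennreal (g d - g c)"
      by (rule vitali_increment[OF mono True _ _ steep]) auto
  qed
  from choice[OF this] obtain B where B: "\<And>n. B n \<in> sets borel" "\<And>n. negligible (?E - B n)"
    "\<And>n. ennreal (real n) * emeasure lborel (B n) \<le> ennreal (g d - g c)"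
    by blast
  have "emeasure lborel (\<Inter>n. B n) = 0"
  proof (rule ccontr)
    assume nz: "emeasure lborel (\<Inter>n. B n) \<noteq> 0"
    have le: "ennreal (real n) * emeasure lborel (\<Inter>n. B n) \<le> ennreal (g d - g c)" for n
    proof -
      have "emeasure lborel (\<Inter>n. B n) \<le> emeasure lborel (B n)"
        using B(1) by (intro emeasure_mono) auto
      then show ?thesis using B(3)[of n] by (meson mult_left_mono order_trans zero_le)
    qed
    then have fin: "emeasure lborel (\<Inter>n. B n) < \<infinity>"
      using le[of 1] by (auto intro: le_less_trans)
    then obtain s where s: "emeasure lborel (\<Inter>n. B n) = ennreal s" "0 < s"
      using nz by (cases "emeasure lborel (\<Inter>n. B n)") (auto simp: le_less)
    obtain n :: nat where "(g d - g c) / s < real n" using reals_Archimedean2 by blast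
    then have "g d - g c < real n * s" using s(2) by (simp add: field_simps)
    moreover have "ennreal (real n * s) \<le> ennreal (g d - g c)"
      using le[of n] s by (simp add: ennreal_mult)
    moreover have "0 \<le> g d - g c" using mono True by (auto simp: mono_on_def)
    ultimately show False by (simp add: ennreal_le_iff)
  qed
  then have "(\<Inter>n. B n) \<in> null_sets lborel" using B(1) by (auto simp: null_sets_def)
  then have "negligible (\<Inter>n. B n)" by (simp add: negligible_iff_null_sets null_sets_completionI)
  moreover have "negligible (\<Union>n. ?E - B n)" using B(2) by (intro negligible_countable_Union) auto
  ultimately have "negligible ((\<Inter>n. B n) \<union> (\<Union>n. ?E - B n))" by (rule negligible_Un)
  then show ?thesis by (rule negligible_subset) auto
qed auto

text \<open>
  A bounded function that does not oscillate across any gap \<open>p < q\<close> converges, namely to the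
  supremum of its eventual lower bounds.
\<close>

lemma tendsto_of_dichotomy:
  fixes Q :: "'b \<Rightarrow> real"
  assumes F: "F \<noteq> bot" and bdd: "eventually (\<lambda>t. \<bar>Q t\<bar> \<le> K) F"
    and dich: "\<And>p q. p < q \<Longrightarrow> eventually (\<lambda>t. p \<le> Q t) F \<or> eventually (\<lambda>t. Q t \<le> q) F"
  shows "\<exists>l. (Q \<longlongrightarrow> l) F"
proof -
  let ?S = "{p. eventually (\<lambda>t. p \<le> Q t) F}"
  have ne: "-K \<in> ?S" using bdd by (auto elim!: eventually_mono)
  have ub: "p \<le> K" if "p \<in> ?S" for p
  proof -
    have "eventually (\<lambda>t. p \<le> K) F"
      using that bdd by simp (rule eventually_elim2, assumption+, auto)
    then show ?thesis using F by simp
  qed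
  then have bd: "bdd_above ?S" by (auto simp: bdd_above_def)
  have "(Q \<longlongrightarrow> Sup ?S) F"
  proof (rule order_tendstoI)
    fix a assume "a < Sup ?S"
    then obtain p where "p \<in> ?S" "a < p" using ne bd by (subst (asm) less_cSup_iff) auto
    then show "eventually (\<lambda>t. a < Q t) F" by (auto elim!: eventually_mono)
  next
    fix a assume a: "Sup ?S < a"
    define p q where "p = (2 * Sup ?S + a) / 3" and "q = (Sup ?S + 2 * a) / 3"
    have pq: "Sup ?S < p" "p < q" "q < a" using a by (auto simp: p_def q_def field_simps)
    then have "p \<notin> ?S" using bd by (metis cSup_upper leD)
    then have "eventually (\<lambda>t. Q t \<le> q) F" using dich[OF pq(2)] by auto
    then show "eventually (\<lambda>t. Q t < a) F" using pq by (auto elim!: eventually_mono)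
  qed
  then show ?thesis by blast
qed

lemma negligible_borel_iff_null_sets:
  fixes S :: "real set"
  assumes "S \<in> sets borel"
  shows "negligible S \<longleftrightarrow> S \<in> null_sets lborel"
  using assms by (simp add: negligible_iff_null_sets null_sets_completion_iff)

text \<open>
  The covering theorem is used twice.  In an open set \<open>U\<close> of measure at most \<open>|E| + e\<close> around \<open>E\<close>,
  disjoint intervals of slope at most \<open>p\<close> cover almost all of \<open>E\<close>; inside each of them, intervals
  of slope at least \<open>q\<close> do so again.  Comparing the increments of \<open>g\<close> gives
  \<open>q |E| \<le> p (|E| + e)\<close>.
\<close>

lemma emeasure_zero_of_gap_in_slopes:
  fixes g :: "real \<Rightarrow> real"
  assumes mono: "mono g" and pq: "0 \<le> p" "p < q" and E: "E \<in> sets borel" "E \<subseteq> {a<..<b}"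
    and low: "\<And>x e. \<lbrakk>x \<in> E; 0 < e\<rbrakk> \<Longrightarrow>
      \<exists>u v. u < x \<and> x < v \<and> v - u < e \<and> g v - g u \<le> p * (v - u)"
    and high: "\<And>x e. \<lbrakk>x \<in> E; 0 < e\<rbrakk> \<Longrightarrow>
      \<exists>u v. u \<le> x \<and> x \<le> v \<and> u < v \<and> v - u < e \<and> q * (v - u) \<le> g v - g u"
  shows "emeasure lborel E = 0"
proof -
  have main: "ennreal q * emeasure lborel E \<le> ennreal p * (emeasure lborel E + ennreal e)"
    if "0 < e" for e
  proof -
    obtain U where U: "open U" "E \<subseteq> U" "emeasure lborel (U - E) < ennreal e"
      using outer_regular_lborel[OF E(1) \<open>0 < e\<close>] by blast
    let ?J = "\<lambda>r :: real \<times> real. {fst r<..<snd r}"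
    let ?K = "{r. fst r < snd r \<and> ?J r \<subseteq> U \<and> g (snd r) - g (fst r) \<le> p * (snd r - fst r)}"
    let ?a = "\<lambda>p :: real \<times> real. (fst p + snd p) / 2" and ?r = "\<lambda>p :: real \<times> real. (snd p - fst p) / 2"
    have ball: "ball (?a r) (?r r) = ?J r" for r
      by (simp add: ball_eq_greaterThanLessThan field_simps)
    have cover: "\<exists>r. r \<in> ?K \<and> x \<in> ball (?a r) (?r r) \<and> ?r r < d" if x: "x \<in> E" "0 < d" for x d
    proof -
      obtain \<delta> where \<delta>: "0 < \<delta>" "ball x \<delta> \<subseteq> U" using U x openE by blast
      then obtain u v where uv: "u < x" "x < v" "v - u < min d \<delta>" "g v - g u \<le> p * (v - u)"
        using low[OF x(1), of "min d \<delta>"] x(2) by auto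
      have "{u<..<v} \<subseteq> ball x \<delta>" using uv by (auto simp: dist_real_def)
      then have "(u, v) \<in> ?K" using uv \<delta> by auto
      then show ?thesis
        using uv unfolding ball by (intro exI[of _ "(u, v)"]) simp
    qed
    obtain C where C: "countable C" "C \<subseteq> ?K"
       "pairwise (\<lambda>i j. disjnt (ball (?a i) (?r i)) (ball (?a j) (?r j))) C"
       "negligible (E - (\<Union>i \<in> C. ball (?a i) (?r i)))"
      using Vitali_covering_theorem_balls[of E ?K ?a ?r, OF cover] by blast
    have disj: "disjoint_family_on ?J C"
      using C(3) unfolding pairwise_def disjnt_def ball disjoint_family_on_def by blast
    then have disj': "disjoint_family_on (\<lambda>r. A r \<inter> ?J r) C" for A
      unfolding disjoint_family_on_def by blast
    have "\<forall>r\<in>C. \<exists>B. B \<in> sets borel \<and> negligible (E \<inter> ?J r - B) \<and>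
        ennreal q * emeasure lborel B \<le> ennreal (g (snd r) - g (fst r))"
    proof
      fix r assume "r \<in> C"
      then have "fst r \<le> snd r" using C(2) by auto
      then show "\<exists>B. B \<in> sets borel \<and> negligible (E \<inter> ?J r - B) \<and>
        ennreal q * emeasure lborel B \<le> ennreal (g (snd r) - g (fst r))"
        using pq mono high by (intro vitali_increment) (auto intro: mono_imp_mono_on)
    qed
    from bchoice[OF this] obtain B where B: "\<And>r. r \<in> C \<Longrightarrow> B r \<in> sets borel"
      "\<And>r. r \<in> C \<Longrightarrow> negligible (E \<inter> ?J r - B r)"
      "\<And>r. r \<in> C \<Longrightarrow> ennreal q * emeasure lborel (B r) \<le> ennreal (g (snd r) - g (fst r))"
      by blast
    let ?B = "\<Union>r\<in>C. B r \<inter> ?J r"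
    have B_borel: "?B \<in> sets borel"
      using B(1) C(1) by (intro sets.countable_UN') auto
    have "negligible (E - ?B)"
    proof (rule negligible_subset)
      show "E - ?B \<subseteq> (E - (\<Union>r\<in>C. ?J r)) \<union> (\<Union>r\<in>C. E \<inter> ?J r - B r)" by blast
      show "negligible ((E - (\<Union>r\<in>C. ?J r)) \<union> (\<Union>r\<in>C. E \<inter> ?J r - B r))"
        using C(1,4) B(2) unfolding ball
        by (intro negligible_Un negligible_countable_Union) auto
    qed
    then have null: "E - ?B \<in> null_sets lborel"
      using E(1) B_borel by (subst (asm) negligible_borel_iff_null_sets) auto
    have "emeasure lborel E \<le> emeasure lborel (?B \<union> (E - ?B))"
      using E(1) B_borel by (intro emeasure_mono) auto
    also have "\<dots> = emeasure lborel ?B"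
      using B_borel null by (intro emeasure_Un_null_set) auto
    finally have "ennreal q * emeasure lborel E \<le> ennreal q * emeasure lborel ?B"
      by (rule mult_left_mono) simp
    also have "\<dots> = (\<integral>\<^sup>+r. ennreal q * emeasure lborel (B r \<inter> ?J r) \<partial>count_space C)"
      using C(1) disj' B(1)
      by (subst emeasure_UN_countable) (auto simp: nn_integral_cmult)
    also have "\<dots> \<le> (\<integral>\<^sup>+r. ennreal p * emeasure lborel (?J r) \<partial>count_space C)"
    proof (rule nn_integral_mono)
      fix r assume "r \<in> space (count_space C)"
      then have r: "r \<in> C" "r \<in> ?K" using C(2) by auto
      have "ennreal q * emeasure lborel (B r \<inter> ?J r) \<le> ennreal q * emeasure lborel (B r)"
        using B(1)[OF r(1)] by (intro mult_left_mono emeasure_mono) auto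
      also have "\<dots> \<le> ennreal (p * (snd r - fst r))"
        using B(3)[OF r(1)] r(2) by (auto intro: order_trans ennreal_leI)
      also have "\<dots> = ennreal p * emeasure lborel (?J r)"
        using r pq by (auto simp: ennreal_mult)
      finally show "ennreal q * emeasure lborel (B r \<inter> ?J r) \<le> ennreal p * emeasure lborel (?J r)" .
    qed
    also have "\<dots> = ennreal p * emeasure lborel (\<Union>r\<in>C. ?J r)"
      using C(1) disj
      by (subst emeasure_UN_countable) (auto simp: nn_integral_cmult)
    also have "\<dots> \<le> ennreal p * emeasure lborel (E \<union> (U - E))"
      using C(2) E(1) U by (intro mult_left_mono emeasure_mono) auto
    also have "\<dots> \<le> ennreal p * (emeasure lborel E + emeasure lborel (U - E))"
      using E(1) U by (intro mult_left_mono emeasure_subadditive) auto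
    also have "\<dots> \<le> ennreal p * (emeasure lborel E + ennreal e)"
      using U(3) by (intro mult_left_mono add_left_mono) auto
    finally show ?thesis .
  qed
  have "emeasure lborel E \<le> emeasure lborel {a<..<b}" using E by (intro emeasure_mono) auto
  also have "\<dots> < \<infinity>" by (cases "a \<le> b") auto
  finally obtain s where s: "emeasure lborel E = ennreal s" "0 \<le> s"
    by (cases "emeasure lborel E") auto
  have "q * s \<le> p * s + e" if e: "0 < e" for e
  proof -
    \<comment> \<open>Dividing by \<open>p + 1\<close> instead of \<open>p\<close> covers the case \<open>p = 0\<close>.\<close>
    have "0 < e / (p + 1)" using e pq by simp
    from main[OF this] have "ennreal (q * s) \<le> ennreal (p * (s + e / (p + 1)))"
      using s pq e by (simp add: ennreal_mult[symmetric] ennreal_plus[symmetric] del: ennreal_plus)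
    then have "q * s \<le> p * (s + e / (p + 1))" using s pq e by (simp add: ennreal_le_iff)
    also have "\<dots> \<le> p * s + e" using pq e by (simp add: field_simps)
    finally show ?thesis .
  qed
  then have "q * s \<le> p * s" by (rule field_le_epsilon)
  then have "s = 0" using pq s by (simp add: mult_le_cancel_right)
  then show ?thesis using s by simp
qed

text \<open>
  Lebesgue's differentiation theorem, for continuous functions.  The sets \<open>Low\<close> and \<open>High\<close> are open;
  by continuity an interval with endpoint \<open>x\<close> can be widened so that it contains \<open>x\<close> in its
  interior without spoiling a strict bound on its slope.  Hence the set \<open>E p q\<close> of points at which
  the slopes oscillate across the gap from \<open>p\<close> to \<open>q\<close> is Borel.
\<close>

lemma negligible_not_differentiable_mono_continuous:
  fixes g :: "real \<Rightarrow> real"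
  assumes mono: "mono g" and cont: "continuous_on UNIV g"
  shows "negligible {x. \<not> (\<exists>l. ((\<lambda>t. (g (x + t) - g x) / t) \<longlongrightarrow> l) (at 0))}"
proof -
  define Low where "Low p n = \<Union>{{u<..<v} | u v. v - u < 1 / real (Suc n) \<and> g v - g u < p * (v - u)}" for p n
  define High where "High q n = \<Union>{{u<..<v} | u v. v - u < 1 / real (Suc n) \<and> q * (v - u) < g v - g u}" for q n
  define E where "E p q = (\<Inter>n. Low p n) \<inter> (\<Inter>n. High q n)" for p q
  have open_LH: "open (Low p n)" "open (High p n)" for p n
    unfolding Low_def High_def by (intro open_Union; force)+
  then have E_borel: "E p q \<in> sets borel" for p q
    unfolding E_def by (intro sets.Int sets.countable_INT') auto
  have inv: "\<exists>n. 1 / real (Suc n) < e" if "0 < e" for e :: real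
    using that by (metis inverse_eq_divide reals_Archimedean)
  have low: "\<exists>u v. u < x \<and> x < v \<and> v - u < e \<and> g v - g u \<le> p * (v - u)"
    if x: "x \<in> E p q" "0 < e" for x e p q
  proof -
    obtain n where n: "1 / real (Suc n) < e" using inv x(2) by blast
    have "x \<in> Low p n" using x by (auto simp: E_def)
    then obtain u v where "u < x" "x < v" "v - u < 1 / real (Suc n)" "g v - g u < p * (v - u)"
      by (auto simp: Low_def)
    then show ?thesis using n by (intro exI[of _ u] exI[of _ v]) auto
  qed
  have high: "\<exists>u v. u \<le> x \<and> x \<le> v \<and> u < v \<and> v - u < e \<and> q * (v - u) \<le> g v - g u"
    if x: "x \<in> E p q" "0 < e" for x e p q
  proof -
    obtain n where n: "1 / real (Suc n) < e" using inv x(2) by blast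
    have "x \<in> High q n" using x by (auto simp: E_def)
    then obtain u v where "u < x" "x < v" "v - u < 1 / real (Suc n)" "q * (v - u) < g v - g u"
      by (auto simp: High_def)
    then show ?thesis using n by (intro exI[of _ u] exI[of _ v]) auto
  qed
  have E_neg: "negligible (E p q)" if "0 \<le> p" "p < q" for p q
  proof -
    have "emeasure lborel (E p q \<inter> {- real n<..<real n}) = 0" for n
      using that low high E_borel
      by (intro emeasure_zero_of_gap_in_slopes[OF mono, where p=p and q=q]) auto
    then have "negligible (E p q \<inter> {- real n<..<real n})" for n
      using E_borel by (subst negligible_borel_iff_null_sets) (auto simp: null_sets_def)
    then have "negligible (\<Union>n. E p q \<inter> {- real n<..<real n})"
      by (intro negligible_countable_Union) auto
    moreover have "E p q \<subseteq> (\<Union>n. E p q \<inter> {- real n<..<real n})"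
    proof
      fix x assume "x \<in> E p q"
      moreover obtain n where "\<bar>x\<bar> < real n" using reals_Archimedean2 by blast
      ultimately have "x \<in> E p q \<inter> {- real n<..<real n}" by auto
      then show "x \<in> (\<Union>n. E p q \<inter> {- real n<..<real n})" by blast
    qed
    ultimately show ?thesis by (rule negligible_subset)
  qed
  let ?N1 = "\<Union>n. {- real n<..<real n} - pointwise_lipschitz_set g"
  let ?R = "{(p, q). p \<in> \<rat> \<and> q \<in> \<rat> \<and> 0 \<le> p \<and> p < q}"
  let ?N2 = "\<Union>(p, q)\<in>?R. E p q"
  have "negligible ?N1"
    using mono by (intro negligible_countable_Union)
      (auto intro!: negligible_not_pointwise_lipschitz_mono[OF mono_imp_mono_on])
  moreover have "negligible ?N2"
  proof -
    have "countable ?R" by (rule countable_subset[of _ "\<rat> \<times> \<rat>"]) (auto intro: countable_rat)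
    then show ?thesis using E_neg by (intro negligible_countable_Union) auto
  qed
  ultimately have "negligible (?N1 \<union> ?N2)" by (rule negligible_Un)
  moreover have "\<exists>l. ((\<lambda>t. (g (x + t) - g x) / t) \<longlongrightarrow> l) (at 0)" if x: "x \<notin> ?N1 \<union> ?N2" for x
  proof -
    let ?Q = "\<lambda>t. (g (x + t) - g x) / t"
    obtain n where "\<bar>x\<bar> < real n" using reals_Archimedean2 by blast
    then have "x \<in> pointwise_lipschitz_set g" using x by (auto simp: abs_less_iff)
    then obtain k where k: "\<And>y. dist y x < 1 / real (Suc k) \<Longrightarrow> \<bar>g y - g x\<bar> \<le> real (Suc k) * dist y x"
      by (auto simp: pointwise_lipschitz_set_def lip_points_def)
    have bdd: "eventually (\<lambda>t. \<bar>?Q t\<bar> \<le> real (Suc k)) (at 0)"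
      unfolding eventually_at
    proof (intro exI[of _ "1 / real (Suc k)"] conjI ballI impI)
      fix t :: real assume t: "t \<noteq> 0 \<and> dist t 0 < 1 / real (Suc k)"
      then have "\<bar>g (x + t) - g x\<bar> \<le> real (Suc k) * \<bar>t\<bar>"
        using k[of "x + t"] by (simp add: dist_real_def)
      then show "\<bar>?Q t\<bar> \<le> real (Suc k)" using t by (simp add: abs_divide field_simps)
    qed simp
    have tend: "((\<lambda>h. g (y + h)) \<longlongrightarrow> g y) (at_right 0)" "((\<lambda>h. g (y - h)) \<longlongrightarrow> g y) (at_right 0)" for y
    proof -
      have "isCont g (y + 0)" "isCont g (y - 0)"
        using cont by (auto simp: continuous_on_eq_continuous_at)
      then show "((\<lambda>h. g (y + h)) \<longlongrightarrow> g y) (at_right 0)" "((\<lambda>h. g (y - h)) \<longlongrightarrow> g y) (at_right 0)"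
        by (auto intro!: tendsto_eq_intros isCont_tendsto_compose[of _ g])
    qed
    \<comment> \<open>A slope of an interval with endpoint \<open>x\<close> is the limit of slopes of intervals around \<open>x\<close>.\<close>
    have widen: "\<exists>u v. u < x \<and> x < v \<and> v - u < e \<and> P (g v - g u) (v - u)"
      if t: "t \<noteq> 0" "\<bar>t\<bar> < e" and P: "P = (\<lambda>y d. y < c * d) \<or> P = (\<lambda>y d. c * d < y)"
        and at: "P ((g (x + t) - g x) * sgn t) \<bar>t\<bar>" for t e c P
    proof -
      define u v where "u = min x (x + t)" and "v = max x (x + t)"
      have uv: "u \<le> x" "x \<le> v" "v - u < e" "P (g v - g u) (v - u)"
        using t at by (auto simp: u_def v_def min_def max_def sgn_if split: if_splits)
      have "eventually (\<lambda>h. P (g (v + h) - g (u - h)) ((v + h) - (u - h))) (at_right 0)"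
      proof -
        have lim: "((\<lambda>h. (g (v + h) - g (u - h)) - c * ((v + h) - (u - h))) \<longlongrightarrow>
            (g v - g u) - c * ((v + 0) - (u - 0))) (at_right 0)"
          by (intro tendsto_intros tend)
        show ?thesis
          using P
        proof
          assume "P = (\<lambda>y d. y < c * d)"
          then show ?thesis using order_tendstoD(2)[OF lim, of 0] uv by (auto elim: eventually_mono)
        next
          assume "P = (\<lambda>y d. c * d < y)"
          then show ?thesis using order_tendstoD(1)[OF lim, of 0] uv by (auto elim: eventually_mono)
        qed
      qed
      moreover have "eventually (\<lambda>h. h < (e - (v - u)) / 2) (at_right (0::real))"
        using uv by (intro eventually_at_right_less[THEN eventually_mono] order_tendstoD) (auto intro!: tendsto_intros)
      moreover have "eventually (\<lambda>h. 0 < h) (at_right (0::real))"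
        by (simp add: eventually_at_right_less)
      ultimately have "eventually (\<lambda>h. P (g (v + h) - g (u - h)) ((v + h) - (u - h)) \<and>
          h < (e - (v - u)) / 2 \<and> 0 < h) (at_right 0)"
        by (intro eventually_conj)
      then obtain h where "P (g (v + h) - g (u - h)) ((v + h) - (u - h))" "h < (e - (v - u)) / 2" "0 < h"
        using eventually_happens'[OF trivial_limit_at_right_real] by blast
      then show ?thesis
        using uv by (intro exI[of _ "u - h"] exI[of _ "v + h"]) (auto simp: field_simps)
    qed
    have dich: "eventually (\<lambda>t. p \<le> ?Q t) (at 0) \<or> eventually (\<lambda>t. ?Q t \<le> q) (at 0)"
      if pq: "p < q" "0 \<le> p" "p \<in> \<rat>" "q \<in> \<rat>" for p q
    proof -
      have "x \<notin> E p q" using x pq by auto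
      then obtain n where n: "x \<notin> Low p n \<or> x \<notin> High q n" by (auto simp: E_def)
      have ev: "eventually (\<lambda>t. t \<noteq> 0 \<and> \<bar>t\<bar> < 1 / real (Suc n)) (at (0::real))"
        unfolding eventually_at by (intro exI[of _ "1 / real (Suc n)"]) auto
      from n show ?thesis
      proof
        assume nL: "x \<notin> Low p n"
        have "p \<le> ?Q t" if t: "t \<noteq> 0 \<and> \<bar>t\<bar> < 1 / real (Suc n)" for t
        proof (rule ccontr)
          assume "\<not> ?thesis"
          then have "(g (x + t) - g x) * sgn t < p * \<bar>t\<bar>"
            using t by (cases "t > 0") (auto simp: field_simps not_le)
          then obtain u v where "u < x" "x < v" "v - u < 1 / real (Suc n)" "g v - g u < p * (v - u)"
            using widen[of t "1 / real (Suc n)" "\<lambda>y d. y < p * d" p] t by auto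
          then have "{u<..<v} \<in> {{u<..<v} | u v. v - u < 1 / real (Suc n) \<and> g v - g u < p * (v - u)}"
            "x \<in> {u<..<v}" by auto
          then have "x \<in> Low p n" unfolding Low_def by (rule UnionI)
          then show False using nL by simp
        qed
        then show ?thesis using ev by (auto elim: eventually_mono)
      next
        assume nH: "x \<notin> High q n"
        have "?Q t \<le> q" if t: "t \<noteq> 0 \<and> \<bar>t\<bar> < 1 / real (Suc n)" for t
        proof (rule ccontr)
          assume "\<not> ?thesis"
          then have "q * \<bar>t\<bar> < (g (x + t) - g x) * sgn t"
            using t by (cases "t > 0") (auto simp: field_simps not_le)
          then obtain u v where "u < x" "x < v" "v - u < 1 / real (Suc n)" "q * (v - u) < g v - g u"
            using widen[of t "1 / real (Suc n)" "\<lambda>y d. q * d < y" q] t by auto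
          then have "{u<..<v} \<in> {{u<..<v} | u v. v - u < 1 / real (Suc n) \<and> q * (v - u) < g v - g u}"
            "x \<in> {u<..<v}" by auto
          then have "x \<in> High q n" unfolding High_def by (rule UnionI)
          then show False using nH by simp
        qed
        then show ?thesis using ev by (intro disjI2) (rule eventually_mono)
      qed
    qed
    have "0 \<le> ?Q t" for t
      using monoD[OF mono, of x "x + t"] monoD[OF mono, of "x + t" x]
      by (cases "0 \<le> t") (auto simp: zero_le_divide_iff)
    note Q_nonneg = this
    show ?thesis
    proof (rule tendsto_of_dichotomy[OF _ bdd])
      fix p q :: real assume pq: "p < q"
      show "eventually (\<lambda>t. p \<le> ?Q t) (at 0) \<or> eventually (\<lambda>t. ?Q t \<le> q) (at 0)"
      proof (cases "0 \<le> p")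
        case True
        obtain p' where p': "p' \<in> \<rat>" "p < p'" "p' < q" using Rats_dense_in_real[OF pq] by blast
        obtain q' where q': "q' \<in> \<rat>" "p' < q'" "q' < q" using Rats_dense_in_real[OF p'(3)] by blast
        have "eventually (\<lambda>t. p' \<le> ?Q t) (at 0) \<or> eventually (\<lambda>t. ?Q t \<le> q') (at 0)"
          using dich[of p' q'] p' q' True by auto
        then show ?thesis
          by (rule disj_forward) (use p' q' in \<open>auto elim!: eventually_mono\<close>)
      next
        case False
        then show ?thesis using Q_nonneg by (intro disjI1 always_eventually) (meson linear order_trans)
      qed
    qed simp
  qed
  ultimately show ?thesis
    by (elim negligible_subset) blast
qed

text \<open>
  Adding \<open>L * x\<close> to an \<open>L\<close>-Lipschitz function makes it monotone.
\<close>

lemma negligible_not_differentiable_lipschitz: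
  fixes g :: "real \<Rightarrow> real"
  assumes lip: "L-lipschitz_on UNIV g"
  shows "negligible {x. \<not> (\<exists>l. ((\<lambda>t. (g (x + t) - g x) / t) \<longlongrightarrow> l) (at 0))}"
proof -
  let ?h = "\<lambda>x. g x + L * x"
  have "mono ?h"
  proof (rule monoI)
    fix x y :: real assume "x \<le> y"
    then have "\<bar>g x - g y\<bar> \<le> L * (y - x)"
      using lipschitz_onD[OF lip, of x y] by (simp add: dist_real_def)
    then show "?h x \<le> ?h y" by (simp add: algebra_simps)
  qed
  moreover have "continuous_on UNIV ?h"
    by (intro continuous_intros lipschitz_on_continuous_on[OF lip])
  ultimately have neg: "negligible {x. \<not> (\<exists>l. ((\<lambda>t. (?h (x + t) - ?h x) / t) \<longlongrightarrow> l) (at 0))}"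
    by (rule negligible_not_differentiable_mono_continuous)
  have "\<exists>l. ((\<lambda>t. (g (x + t) - g x) / t) \<longlongrightarrow> l) (at 0)"
    if "((\<lambda>t. (?h (x + t) - ?h x) / t) \<longlongrightarrow> l) (at 0)" for x l
  proof -
    have "((\<lambda>t. (?h (x + t) - ?h x) / t - L) \<longlongrightarrow> l - L) (at 0)"
      using that by (intro tendsto_intros)
    moreover have "eventually (\<lambda>t. (?h (x + t) - ?h x) / t - L = (g (x + t) - g x) / t) (at 0)"
      unfolding eventually_at by (intro exI[of _ 1]) (auto simp: field_simps)
    ultimately show ?thesis by (blast intro: Lim_transform_eventually)
  qed
  then show ?thesis by (intro negligible_subset[OF neg]) blast
qed

section \<open>Sets that are null along lines\<close>

text \<open>
  For \<open>v = 0\<close> the trace of \<open>E\<close> on each line is empty or everything, so only the empty set is null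
  along \<open>0\<close>.
\<close>

definition null_along :: "'a::real_normed_vector \<Rightarrow> 'a set \<Rightarrow> bool" where
  "null_along v E \<longleftrightarrow> (\<forall>x. {t. x + t *\<^sub>R v \<in> E} \<in> null_sets lborel)"

definition decomposes_along :: "(nat \<Rightarrow> 'a::real_normed_vector) \<Rightarrow> 'a set \<Rightarrow> bool" where
  "decomposes_along \<xi> E \<longleftrightarrow>
    (\<exists>A. E = (\<Union>n. A n) \<and> (\<forall>n. A n \<in> sets borel \<and> null_along (\<xi> n) (A n)))"

text \<open>
  This notion differs from \<^const>\<open>aronszajn_null\<close> in the treatment of directions \<open>\<xi> n = 0\<close>: there
  the part \<open>A n\<close> has to be empty.  Strictly null sets are Haar null in every space.  In the
  zero space, by contrast, every set is Aronszajn null, while the whole space is not Haar null.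
\<close>

definition strictly_aronszajn_null :: "'a::real_normed_vector set \<Rightarrow> bool" where
  "strictly_aronszajn_null E \<longleftrightarrow> E \<in> sets borel \<and>
    (\<forall>\<xi>. closure (span (range \<xi>)) = UNIV \<longrightarrow> decomposes_along \<xi> E)"

lemma line_slice_borel:
  fixes x v :: "'a::real_normed_vector"
  assumes "E \<in> sets borel"
  shows "{t. x + t *\<^sub>R v \<in> E} \<in> sets borel"
proof -
  have "(\<lambda>t. x + t *\<^sub>R v) \<in> borel_measurable borel"
    by (intro borel_measurable_continuous_onI continuous_intros)
  from measurable_sets[OF this assms] show ?thesis by (simp add: vimage_def)
qed

lemma null_along_subset:
  assumes "null_along v E" "F \<subseteq> E" "F \<in> sets borel"
  shows "null_along v F"
  unfolding null_along_def
proof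
  fix x
  have "{t. x + t *\<^sub>R v \<in> E} \<in> null_sets lborel" using assms(1) by (simp add: null_along_def)
  then show "{t. x + t *\<^sub>R v \<in> F} \<in> null_sets lborel"
    by (rule null_sets_subset) (use assms line_slice_borel in auto)
qed

lemma null_along_UN:
  assumes "countable I" "\<And>i. i \<in> I \<Longrightarrow> null_along v (E i)"
  shows "null_along v (\<Union>i\<in>I. E i)"
proof -
  have "{t. x + t *\<^sub>R v \<in> (\<Union>i\<in>I. E i)} = (\<Union>i\<in>I. {t. x + t *\<^sub>R v \<in> E i})" for x by auto
  then show ?thesis
    using assms by (auto simp: null_along_def intro!: null_sets_UN')
qed

lemma null_along_scaleR:
  assumes "null_along (c *\<^sub>R v) E" "c \<noteq> 0" "E \<in> sets borel"
  shows "null_along v E"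
  unfolding null_along_def
proof
  fix x
  let ?S = "{t. x + t *\<^sub>R v \<in> E}"
  have S: "?S \<in> sets borel" by (rule line_slice_borel[OF assms(3)])
  have "emeasure lborel ?S = (\<integral>\<^sup>+t. indicator ?S t \<partial>lborel)" using S by simp
  also have "\<dots> = ennreal \<bar>c\<bar> * (\<integral>\<^sup>+t. indicator ?S (0 + c * t) \<partial>lborel)"
    using S assms(2) by (intro nn_integral_real_affine) auto
  also have "(\<integral>\<^sup>+t. indicator ?S (0 + c * t) \<partial>lborel) = (\<integral>\<^sup>+t. indicator {t. x + t *\<^sub>R (c *\<^sub>R v) \<in> E} t \<partial>lborel)"
    by (intro nn_integral_cong) (auto simp: indicator_def mult.commute)
  also have "\<dots> = 0"
    using assms(1) line_slice_borel[OF assms(3), of x "c *\<^sub>R v"]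
    by (auto simp: null_along_def null_sets_def)
  finally show "?S \<in> null_sets lborel" using S by (simp add: null_sets_def)
qed

lemma null_along_zero_iff: "null_along 0 E \<longleftrightarrow> E = {}"
  by (auto simp: null_along_def null_sets_def)

text \<open>
  By Fubini's theorem and a shear, \<open>E\<close> meets every plane \<open>x + s a + t b\<close> in a set of planar
  measure zero.  Points through which the trace on the line in direction \<open>b\<close> is null are put into
  \<open>B\<close>; almost every line in direction \<open>b\<close> has null trace, so the remaining points form a set that
  is null along \<open>a\<close>.
\<close>

lemma null_along_add_split:
  fixes a b :: "'a::{real_normed_vector, second_countable_topology}"
  assumes E: "E \<in> sets borel" and null: "null_along (a + b) E"
  shows "\<exists>A B. A \<in> sets borel \<and> B \<in> sets borel \<and> E = A \<union> B \<and> null_along a A \<and> null_along b B"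
proof -
  let ?slice = "\<lambda>x. {t. x + t *\<^sub>R b \<in> E}"
  define B where "B = {x \<in> E. emeasure lborel (?slice x) = 0}"
  have slice_meas: "(\<lambda>x. emeasure lborel (?slice x)) \<in> borel_measurable borel"
  proof -
    have "(\<lambda>p :: 'a \<times> real. fst p + snd p *\<^sub>R b) \<in> borel_measurable borel"
      by (intro borel_measurable_continuous_onI continuous_intros)
    from measurable_sets[OF this E] have "{p. fst p + snd p *\<^sub>R b \<in> E} \<in> sets (borel :: ('a \<times> real) measure)"
      by (simp add: vimage_def)
    moreover have "sets (borel :: ('a \<times> real) measure) = sets (borel \<Otimes>\<^sub>M lborel)"
      unfolding borel_prod[symmetric] by (rule sets_pair_measure_cong) auto
    ultimately have "{p :: 'a \<times> real. fst p + snd p *\<^sub>R b \<in> E} \<in> sets (borel \<Otimes>\<^sub>M lborel)" by simp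
    from lborel.measurable_emeasure_Pair[OF this] show ?thesis
      by (simp add: vimage_def)
  qed
  have "B = E \<inter> ((\<lambda>x. emeasure lborel (?slice x)) -` {0} \<inter> space borel)"
    by (auto simp: B_def)
  also have "\<dots> \<in> sets borel"
    by (rule sets.Int[OF E measurable_sets[OF slice_meas]]) simp
  finally have B: "B \<in> sets borel" .
  have "null_along b B"
    unfolding null_along_def
  proof
    fix x
    show "{t. x + t *\<^sub>R b \<in> B} \<in> null_sets lborel"
    proof (cases "\<exists>t0. x + t0 *\<^sub>R b \<in> B")
      case True
      then obtain t0 where "emeasure lborel (?slice (x + t0 *\<^sub>R b)) = 0" by (auto simp: B_def)
      then have z: "(\<integral>\<^sup>+t. indicator (?slice (x + t0 *\<^sub>R b)) t \<partial>lborel) = 0"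
        using line_slice_borel[OF E] by simp
      have "(\<integral>\<^sup>+t. indicator (?slice x) t \<partial>lborel) =
          ennreal \<bar>1\<bar> * (\<integral>\<^sup>+t. indicator (?slice x) (t0 + 1 * t) \<partial>lborel)"
        using line_slice_borel[OF E] by (intro nn_integral_real_affine) auto
      also have "\<dots> = (\<integral>\<^sup>+t. indicator (?slice (x + t0 *\<^sub>R b)) t \<partial>lborel)"
        by (simp, intro nn_integral_cong) (auto simp: indicator_def algebra_simps)
      finally have "?slice x \<in> null_sets lborel"
        using z line_slice_borel[OF E] by (simp add: null_sets_def)
      then show ?thesis
        by (rule null_sets_subset) (use line_slice_borel[OF B] in \<open>auto simp: B_def\<close>)
    qed auto
  qed
  moreover have "null_along a (E - B)"
    unfolding null_along_def
  proof
    fix x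
    let ?F = "\<lambda>s t. indicator E (x + s *\<^sub>R a + t *\<^sub>R b) :: ennreal"
    have meas: "(\<lambda>p. indicator E (x + fst p *\<^sub>R a + (c * fst p + snd p) *\<^sub>R b) :: ennreal)
        \<in> borel_measurable (lborel \<Otimes>\<^sub>M lborel)" for c
    proof -
      have "(\<lambda>p :: real \<times> real. x + fst p *\<^sub>R a + (c * fst p + snd p) *\<^sub>R b) \<in> borel_measurable borel"
        by (intro borel_measurable_continuous_onI continuous_intros)
      then have "(\<lambda>p :: real \<times> real. x + fst p *\<^sub>R a + (c * fst p + snd p) *\<^sub>R b)
          \<in> borel_measurable (lborel \<Otimes>\<^sub>M lborel)"
        by (simp add: borel_prod lborel_prod)
      from measurable_compose[OF this borel_measurable_indicator[OF E]] show ?thesis .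
    qed
    have slice_meas': "(\<lambda>t. ?F s t) \<in> borel_measurable borel" for s
    proof -
      have "(\<lambda>t. x + s *\<^sub>R a + t *\<^sub>R b) \<in> borel_measurable borel"
        by (intro borel_measurable_continuous_onI continuous_intros)
      from measurable_compose[OF this borel_measurable_indicator[OF E]] show ?thesis .
    qed
    \<comment> \<open>The shear \<open>(s, t) \<mapsto> (s, s + t)\<close> turns lines in direction \<open>a + b\<close> into horizontal ones.\<close>
    have "(\<integral>\<^sup>+s. \<integral>\<^sup>+t. ?F s t \<partial>lborel \<partial>lborel) = (\<integral>\<^sup>+s. \<integral>\<^sup>+t. ?F s (s + t) \<partial>lborel \<partial>lborel)"
    proof (rule nn_integral_cong)
      fix s :: real
      have "(\<integral>\<^sup>+t. ?F s t \<partial>lborel) = ennreal \<bar>1\<bar> * (\<integral>\<^sup>+t. ?F s (s + 1 * t) \<partial>lborel)"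
        using slice_meas' by (intro nn_integral_real_affine) auto
      then show "(\<integral>\<^sup>+t. ?F s t \<partial>lborel) = (\<integral>\<^sup>+t. ?F s (s + t) \<partial>lborel)" by simp
    qed
    also have "\<dots> = (\<integral>\<^sup>+t. \<integral>\<^sup>+s. ?F s (s + t) \<partial>lborel \<partial>lborel)"
      using meas[of 1] by (subst lborel_pair.Fubini') (auto simp: case_prod_beta')
    also have "\<dots> = (\<integral>\<^sup>+t. emeasure lborel {s. (x + t *\<^sub>R b) + s *\<^sub>R (a + b) \<in> E} \<partial>lborel)"
    proof (rule nn_integral_cong)
      fix t :: real
      have "(\<integral>\<^sup>+s. ?F s (s + t) \<partial>lborel) = (\<integral>\<^sup>+s. indicator {s. (x + t *\<^sub>R b) + s *\<^sub>R (a + b) \<in> E} s \<partial>lborel)"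
        by (intro nn_integral_cong) (auto simp: indicator_def algebra_simps)
      then show "(\<integral>\<^sup>+s. ?F s (s + t) \<partial>lborel) = emeasure lborel {s. (x + t *\<^sub>R b) + s *\<^sub>R (a + b) \<in> E}"
        using line_slice_borel[OF E, of "x + t *\<^sub>R b" "a + b"] by simp
    qed
    also have "\<dots> = 0"
      using null by (simp add: null_along_def null_sets_def)
    finally have "(\<integral>\<^sup>+s. emeasure lborel (?slice (x + s *\<^sub>R a)) \<partial>lborel) = 0"
      using line_slice_borel[OF E] slice_meas'
      by (simp add: nn_integral_indicator[symmetric] indicator_def[abs_def] del: nn_integral_indicator)
    moreover have "(\<lambda>s. emeasure lborel (?slice (x + s *\<^sub>R a))) \<in> borel_measurable lborel"
    proof -
      have "(\<lambda>s. x + s *\<^sub>R a) \<in> borel_measurable borel"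
        by (intro borel_measurable_continuous_onI continuous_intros)
      from measurable_compose[OF this slice_meas] show ?thesis by simp
    qed
    ultimately have "AE s in lborel. emeasure lborel (?slice (x + s *\<^sub>R a)) = 0"
      by (simp add: nn_integral_0_iff_AE)
    then have "AE s in lborel. x + s *\<^sub>R a \<notin> E - B"
      by eventually_elim (auto simp: B_def)
    moreover have "{s. x + s *\<^sub>R a \<in> E - B} \<in> sets borel"
      using E B by (intro line_slice_borel) auto
    ultimately show "{s. x + s *\<^sub>R a \<in> E - B} \<in> null_sets lborel"
      by (subst AE_iff_null_sets) auto
  qed
  moreover have "E = (E - B) \<union> B" by (auto simp: B_def)
  ultimately show ?thesis using E B by (meson sets.Diff)
qed

lemma decomposes_along_subset:
  assumes "decomposes_along \<xi> E" "F \<subseteq> E" "F \<in> sets borel"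
  shows "decomposes_along \<xi> F"
proof -
  obtain A where A: "E = (\<Union>n. A n)" "\<And>n. A n \<in> sets borel" "\<And>n. null_along (\<xi> n) (A n)"
    using assms(1) by (auto simp: decomposes_along_def)
  have "F = (\<Union>n. A n \<inter> F)" using assms(2) A(1) by auto
  moreover have "A n \<inter> F \<in> sets borel \<and> null_along (\<xi> n) (A n \<inter> F)" for n
    using A assms(3) by (auto intro: null_along_subset)
  ultimately show ?thesis unfolding decomposes_along_def by blast
qed

lemma decomposes_along_UN:
  fixes E :: "'i \<Rightarrow> 'a::real_normed_vector set"
  assumes I: "countable I" and dec: "\<And>i. i \<in> I \<Longrightarrow> decomposes_along \<xi> (E i)"
  shows "decomposes_along \<xi> (\<Union>i\<in>I. E i)"
proof -
  have "\<forall>i\<in>I. \<exists>A. E i = (\<Union>n. A n) \<and> (\<forall>n. A n \<in> sets borel \<and> null_along (\<xi> n) (A n))"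
    using dec by (auto simp: decomposes_along_def)
  from bchoice[OF this] obtain A where
    A: "\<forall>i\<in>I. E i = (\<Union>n. A i n) \<and> (\<forall>n. A i n \<in> sets borel \<and> null_along (\<xi> n) (A i n))" ..
  have "(\<Union>i\<in>I. E i) = (\<Union>i\<in>I. \<Union>n. A i n)" using A by (intro SUP_cong) auto
  also have "\<dots> = (\<Union>n. \<Union>i\<in>I. A i n)" by blast
  finally have "(\<Union>i\<in>I. E i) = (\<Union>n. \<Union>i\<in>I. A i n)" .
  moreover have "(\<Union>i\<in>I. A i n) \<in> sets borel" for n
    using A I by (intro sets.countable_UN') auto
  moreover have "null_along (\<xi> n) (\<Union>i\<in>I. A i n)" for n
    using A I by (intro null_along_UN) auto
  ultimately show ?thesis
    unfolding decomposes_along_def by (intro exI[of _ "\<lambda>n. \<Union>i\<in>I. A i n"]) auto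
qed

lemma decomposes_along_Un:
  assumes "decomposes_along \<xi> E" "decomposes_along \<xi> F"
  shows "decomposes_along \<xi> (E \<union> F)"
proof -
  have "decomposes_along \<xi> (\<Union>S\<in>{E, F}. S)"
    by (rule decomposes_along_UN) (use assms in auto)
  then show ?thesis by simp
qed

lemma decomposes_along_empty: "decomposes_along \<xi> {}"
  unfolding decomposes_along_def by (intro exI[of _ "\<lambda>_. {}"]) (auto simp: null_along_def)

text \<open>
  The directions \<open>h\<close> for which all sets that are null along \<open>h\<close> decompose form a linear subspace,
  by the splitting of null sets along a sum of directions.  This makes it enough to check nullity
  along a direction that suits the function at hand, chosen from the dense span of the \<open>\<xi> n\<close>.
\<close>

lemma decomposes_along_of_null_along_span:
  fixes \<xi> :: "nat \<Rightarrow> 'a::{real_normed_vector, second_countable_topology}"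
  assumes "h \<in> span (range \<xi>)" and "E \<in> sets borel" "null_along h E"
  shows "decomposes_along \<xi> E"
proof -
  let ?P = "\<lambda>h. \<forall>E \<in> sets borel. null_along h E \<longrightarrow> decomposes_along \<xi> E"
  have base: "?P (\<xi> n)" for n
  proof (intro ballI impI)
    fix E assume "E \<in> sets borel" "null_along (\<xi> n) E"
    then show "decomposes_along \<xi> E"
      unfolding decomposes_along_def
      by (intro exI[of _ "\<lambda>k. if k = n then E else {}"]) (auto simp: null_along_def split: if_splits)
  qed
  have "?P h"
    using assms(1)
  proof (rule span_induct)
    show "subspace {h. ?P h}"
    proof (intro subspaceI)
      show "0 \<in> {h. ?P h}" by (auto simp: null_along_zero_iff decomposes_along_empty)
    next
      fix a b assume ab: "a \<in> {h. ?P h}" "b \<in> {h. ?P h}"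
      then show "a + b \<in> {h. ?P h}"
        using null_along_add_split[of _ a b] decomposes_along_Un by blast
    next
      fix c a assume a: "a \<in> {h. ?P h}"
      show "c *\<^sub>R a \<in> {h. ?P h}"
      proof (cases "c = 0")
        case True
        then show ?thesis by (auto simp: null_along_zero_iff decomposes_along_empty)
      next
        case False
        then show ?thesis using a null_along_scaleR[of c a] by blast
      qed
    qed
  qed (use base in auto)
  then show ?thesis using assms by blast
qed

lemma strictly_aronszajn_null_UN:
  assumes "countable I" "\<And>i. i \<in> I \<Longrightarrow> strictly_aronszajn_null (E i)"
  shows "strictly_aronszajn_null (\<Union>i\<in>I. E i)"
  using assms by (auto simp: strictly_aronszajn_null_def intro!: sets.countable_UN' decomposes_along_UN)

lemma strictly_aronszajn_null_Un:
  assumes "strictly_aronszajn_null E" "strictly_aronszajn_null F"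
  shows "strictly_aronszajn_null (E \<union> F)"
  using assms by (auto simp: strictly_aronszajn_null_def intro!: decomposes_along_Un)

lemma strictly_aronszajn_null_subset:
  assumes "strictly_aronszajn_null E" "F \<subseteq> E" "F \<in> sets borel"
  shows "strictly_aronszajn_null F"
  using assms by (auto simp: strictly_aronszajn_null_def intro: decomposes_along_subset)

lemma aronszajn_null_Un_strictly:
  assumes "aronszajn_null E" "strictly_aronszajn_null F"
  shows "aronszajn_null (E \<union> F)"
  unfolding aronszajn_null_def
proof (intro conjI allI impI)
  show "E \<union> F \<in> sets borel"
    using assms by (auto simp: aronszajn_null_def strictly_aronszajn_null_def)
  fix \<xi> :: "nat \<Rightarrow> 'a" assume \<xi>: "closure (span (range \<xi>)) = UNIV"
  obtain A where A: "E = (\<Union>n. A n)" "\<And>n. A n \<in> sets borel"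
      "\<And>n. \<xi> n \<noteq> 0 \<longrightarrow> (\<forall>x. {t::real. x + t *\<^sub>R \<xi> n \<in> A n} \<in> null_sets lborel)"
    using assms(1) \<xi> unfolding aronszajn_null_def by metis
  obtain B where B: "F = (\<Union>n. B n)" "\<And>n. B n \<in> sets borel" "\<And>n. null_along (\<xi> n) (B n)"
    using assms(2) \<xi> unfolding strictly_aronszajn_null_def decomposes_along_def by metis
  have "{t::real. x + t *\<^sub>R \<xi> n \<in> A n \<union> B n} \<in> null_sets lborel" if "\<xi> n \<noteq> 0" for n x
  proof -
    have "{t::real. x + t *\<^sub>R \<xi> n \<in> A n \<union> B n} = {t. x + t *\<^sub>R \<xi> n \<in> A n} \<union> {t. x + t *\<^sub>R \<xi> n \<in> B n}"
      by auto
    then show ?thesis using A(3) B(3) that by (auto simp: null_along_def)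
  qed
  then show "\<exists>A. E \<union> F = (\<Union>n. A n) \<and> (\<forall>n. A n \<in> sets borel \<and>
      (\<xi> n \<noteq> 0 \<longrightarrow> (\<forall>x. {t::real. x + t *\<^sub>R \<xi> n \<in> A n} \<in> null_sets lborel)))"
    using A B by (intro exI[of _ "\<lambda>n. A n \<union> B n"]) auto
qed

lemma aronszajn_null_empty: "aronszajn_null {}"
  by (auto simp: aronszajn_null_def intro!: exI[of _ "\<lambda>_. {}"])

section \<open>Lipschitz functions on a normed space\<close>

lemma ex_inverse_Suc_less:
  fixes e :: real
  assumes "0 < e"
  obtains n where "1 / real (Suc n) < e"
  using assms by (metis inverse_eq_divide reals_Archimedean)

lemma countable_dense_subset:
  fixes S :: "'a::second_countable_topology set"
  obtains T where "countable T" "T \<subseteq> S" "closure S \<subseteq> closure T"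
proof -
  obtain B :: "'a set set" where B: "countable B" "topological_basis B"
    using ex_countable_basis by blast
  define c where "c b = (SOME x. x \<in> b \<inter> S)" for b
  have c: "c b \<in> b \<inter> S" if "b \<inter> S \<noteq> {}" for b
    unfolding c_def by (rule someI_ex) (use that in blast)
  let ?T = "c ` {b \<in> B. b \<inter> S \<noteq> {}}"
  have "closure S \<subseteq> closure ?T"
  proof
    fix x assume x: "x \<in> closure S"
    have "\<exists>y\<in>?T. y \<in> U" if U: "open U" "x \<in> U" for U
    proof -
      obtain b where b: "b \<in> B" "x \<in> b" "b \<subseteq> U" by (rule topological_basisE[OF B(2) U])
      have "open b" by (rule topological_basis_open[OF B(2) b(1)])
      moreover have "b \<inter> closure S \<noteq> {}" using x b(2) by auto
      ultimately have "b \<inter> S \<noteq> {}" by (simp add: open_Int_closure_eq_empty)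
      then show ?thesis using c[of b] b by (intro bexI[of _ "c b"]) auto
    qed
    from this[of "- closure ?T"] show "x \<in> closure ?T"
      using closure_subset[of ?T] by (meson ComplD ComplI closed_closure open_Compl subsetD)
  qed
  then show thesis using B(1) c by (intro that[of ?T]) auto
qed

definition diff_quotient :: "('a::real_vector \<Rightarrow> real) \<Rightarrow> 'a \<Rightarrow> 'a \<Rightarrow> real \<Rightarrow> real" where
  "diff_quotient f x h t = (f (x + t *\<^sub>R h) - f x) / t"

definition directionally_differentiable_set :: "('a::real_normed_vector \<Rightarrow> real) \<Rightarrow> 'a \<Rightarrow> 'a set" where
  "directionally_differentiable_set f h = {x. \<exists>l. (diff_quotient f x h \<longlongrightarrow> l) (at 0)}"

definition additivity_defect :: "('a::real_vector \<Rightarrow> real) \<Rightarrow> 'a \<Rightarrow> 'a \<Rightarrow> 'a \<Rightarrow> real \<Rightarrow> real" where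
  "additivity_defect f h k x t = diff_quotient f x (h + k) t - diff_quotient f x h t - diff_quotient f x k t"

text \<open>
  The defect is required to vanish in the limit even where the three quotients do not converge
  separately; in this form the condition passes to limits in \<open>h\<close> and \<open>k\<close>, for a Lipschitz
  function.
\<close>

definition additive_derivative_set :: "('a::real_normed_vector \<Rightarrow> real) \<Rightarrow> 'a \<Rightarrow> 'a \<Rightarrow> 'a set" where
  "additive_derivative_set f h k = {x. (additivity_defect f h k x \<longlongrightarrow> 0) (at 0)}"

definition small_steps :: "nat \<Rightarrow> real set" where
  "small_steps m = {t. t \<noteq> 0 \<and> \<bar>t\<bar> < 1 / real (Suc m)}"

lemma eventually_at_0_iff_small_steps:
  "eventually P (at (0::real)) \<longleftrightarrow> (\<exists>m. \<forall>t\<in>small_steps m. P t)"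
proof
  assume "eventually P (at (0::real))"
  then obtain d where d: "0 < d" "\<And>t. t \<noteq> 0 \<Longrightarrow> \<bar>t\<bar> < d \<Longrightarrow> P t"
    by (auto simp: eventually_at dist_real_def)
  obtain m where "1 / real (Suc m) < d" using ex_inverse_Suc_less[OF d(1)] .
  then show "\<exists>m. \<forall>t\<in>small_steps m. P t" using d(2) by (auto simp: small_steps_def intro!: exI[of _ m])
next
  assume "\<exists>m. \<forall>t\<in>small_steps m. P t"
  then obtain m where "\<forall>t\<in>small_steps m. P t" ..
  then show "eventually P (at 0)"
    by (auto simp: eventually_at small_steps_def dist_real_def intro!: exI[of _ "1 / real (Suc m)"])
qed

lemma small_steps_nonempty: "small_steps m \<noteq> {}"
proof -
  have "1 / (2 * real (Suc m)) \<in> small_steps m" by (simp add: small_steps_def field_simps)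
  then show ?thesis by blast
qed

lemma continuous_diff_quotient:
  fixes f :: "'a::real_normed_vector \<Rightarrow> real"
  assumes "continuous_on UNIV f"
  shows "continuous_on UNIV (\<lambda>x. diff_quotient f x h t)"
proof (cases "t = 0")
  case False
  have "continuous_on UNIV (\<lambda>x. f (x + t *\<^sub>R h))"
    by (rule continuous_on_compose2[OF assms]) (auto intro!: continuous_intros)
  then show ?thesis using False assms unfolding diff_quotient_def by (intro continuous_intros) auto
qed (simp add: diff_quotient_def)

text \<open>
  For a continuous function \<open>f\<close> the right-hand side describes the points of differentiability in a
  fixed direction by countable unions and intersections of closed sets.
\<close>

lemma convergent_at_0_iff_Cauchy:
  fixes Q :: "real \<Rightarrow> real"
  shows "(\<exists>l. (Q \<longlongrightarrow> l) (at 0)) \<longleftrightarrow>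
    (\<forall>n. \<exists>m. \<forall>s\<in>small_steps m. \<forall>t\<in>small_steps m. \<bar>Q s - Q t\<bar> \<le> 1 / real (Suc n))"
    (is "?L \<longleftrightarrow> ?R")
proof
  assume ?L
  then obtain l where l: "(Q \<longlongrightarrow> l) (at 0)" ..
  show ?R
  proof
    fix n
    have "eventually (\<lambda>t. dist (Q t) l < 1 / (2 * real (Suc n))) (at 0)"
      using l by (rule tendstoD) simp
    then obtain m where m: "\<And>t. t \<in> small_steps m \<Longrightarrow> dist (Q t) l < 1 / (2 * real (Suc n))"
      by (auto simp: eventually_at_0_iff_small_steps)
    have "\<bar>Q s - Q t\<bar> \<le> 1 / real (Suc n)" if st: "s \<in> small_steps m" "t \<in> small_steps m" for s t
    proof -
      have "\<bar>Q s - Q t\<bar> \<le> 1 / (2 * real (Suc n)) + 1 / (2 * real (Suc n))"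
        using m[OF st(1)] m[OF st(2)] by (simp add: dist_real_def)
      then show ?thesis by (simp add: field_simps)
    qed
    then show "\<exists>m. \<forall>s\<in>small_steps m. \<forall>t\<in>small_steps m. \<bar>Q s - Q t\<bar> \<le> 1 / real (Suc n)" by blast
  qed
next
  assume R: ?R
  obtain m0 where m0: "\<And>s t. s \<in> small_steps m0 \<Longrightarrow> t \<in> small_steps m0 \<Longrightarrow> \<bar>Q s - Q t\<bar> \<le> 1"
    using spec[OF R, of 0] by auto
  obtain t0 where "t0 \<in> small_steps m0" using small_steps_nonempty by blast
  then have "\<forall>t\<in>small_steps m0. \<bar>Q t\<bar> \<le> \<bar>Q t0\<bar> + 1" using m0 by fastforce
  then have bdd: "eventually (\<lambda>t. \<bar>Q t\<bar> \<le> \<bar>Q t0\<bar> + 1) (at 0)"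
    unfolding eventually_at_0_iff_small_steps by blast
  show ?L
  proof (rule tendsto_of_dichotomy[OF _ bdd])
    fix p q :: real assume "p < q"
    then obtain n where n: "1 / real (Suc n) < q - p" using ex_inverse_Suc_less[of "q - p"] by auto
    obtain m where m: "\<And>s t. s \<in> small_steps m \<Longrightarrow> t \<in> small_steps m \<Longrightarrow> \<bar>Q s - Q t\<bar> \<le> 1 / real (Suc n)"
      using R by blast
    show "eventually (\<lambda>t. p \<le> Q t) (at 0) \<or> eventually (\<lambda>t. Q t \<le> q) (at 0)"
    proof (cases "\<forall>t\<in>small_steps m. p \<le> Q t")
      case True
      then show ?thesis unfolding eventually_at_0_iff_small_steps by blast
    next
      case False
      then obtain t where t: "t \<in> small_steps m" "Q t < p" by (auto simp: not_le)
      have "\<forall>s\<in>small_steps m. Q s \<le> q"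
      proof
        fix s assume "s \<in> small_steps m"
        then show "Q s \<le> q" using m[of s t] t n by linarith
      qed
      then show ?thesis unfolding eventually_at_0_iff_small_steps by blast
    qed
  qed simp
qed

lemma directionally_differentiable_set_borel:
  fixes f :: "'a::real_normed_vector \<Rightarrow> real"
  assumes "continuous_on UNIV f"
  shows "directionally_differentiable_set f h \<in> sets borel"
proof -
  let ?C = "\<lambda>n m. {x. \<forall>s\<in>small_steps m. \<forall>t\<in>small_steps m.
      \<bar>diff_quotient f x h s - diff_quotient f x h t\<bar> \<le> 1 / real (Suc n)}"
  have "closed (?C n m)" for n m
    unfolding Collect_ball_eq
    by (intro closed_INT ballI closed_Collect_le continuous_intros continuous_diff_quotient assms)
  then have "(\<Inter>n. \<Union>m. ?C n m) \<in> sets borel"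
    by (intro sets.countable_INT' sets.countable_UN') auto
  also have "(\<Inter>n. \<Union>m. ?C n m) = directionally_differentiable_set f h"
    unfolding directionally_differentiable_set_def convergent_at_0_iff_Cauchy by auto
  finally show ?thesis .
qed

lemma additive_derivative_set_borel:
  fixes f :: "'a::real_normed_vector \<Rightarrow> real"
  assumes "continuous_on UNIV f"
  shows "additive_derivative_set f h k \<in> sets borel"
proof -
  let ?C = "\<lambda>n m. {x. \<forall>t\<in>small_steps m. \<bar>additivity_defect f h k x t\<bar> \<le> 1 / real (Suc n)}"
  have "closed (?C n m)" for n m
    unfolding Collect_ball_eq additivity_defect_def
    by (intro closed_INT ballI closed_Collect_le continuous_intros continuous_diff_quotient assms)
  then have "(\<Inter>n. \<Union>m. ?C n m) \<in> sets borel"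
    by (intro sets.countable_INT' sets.countable_UN') auto
  also have "(\<Inter>n. \<Union>m. ?C n m) = additive_derivative_set f h k"
  proof -
    have "(\<forall>n. \<exists>m. \<forall>t\<in>small_steps m. \<bar>Q t\<bar> \<le> 1 / real (Suc n)) \<longleftrightarrow> (Q \<longlongrightarrow> 0) (at 0)" for Q
    proof
      assume L: "\<forall>n. \<exists>m. \<forall>t\<in>small_steps m. \<bar>Q t\<bar> \<le> 1 / real (Suc n)"
      show "(Q \<longlongrightarrow> 0) (at 0)"
      proof (rule tendstoI)
        fix e :: real assume "0 < e"
        then obtain n where n: "1 / real (Suc n) < e" using ex_inverse_Suc_less by blast
        obtain m where "\<forall>t\<in>small_steps m. \<bar>Q t\<bar> \<le> 1 / real (Suc n)" using L by blast
        then have "\<forall>t\<in>small_steps m. dist (Q t) 0 < e" using n by fastforce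
        then show "eventually (\<lambda>t. dist (Q t) 0 < e) (at 0)"
          unfolding eventually_at_0_iff_small_steps by blast
      qed
    next
      assume Q: "(Q \<longlongrightarrow> 0) (at 0)"
      show "\<forall>n. \<exists>m. \<forall>t\<in>small_steps m. \<bar>Q t\<bar> \<le> 1 / real (Suc n)"
      proof
        fix n
        have "eventually (\<lambda>t. dist (Q t) 0 < 1 / real (Suc n)) (at 0)" using Q by (rule tendstoD) simp
        then show "\<exists>m. \<forall>t\<in>small_steps m. \<bar>Q t\<bar> \<le> 1 / real (Suc n)"
          unfolding eventually_at_0_iff_small_steps by (auto intro: less_imp_le)
      qed
    qed
    note iff = this
    have "(\<Inter>n. \<Union>m. ?C n m) =
        {x. \<forall>n. \<exists>m. \<forall>t\<in>small_steps m. \<bar>additivity_defect f h k x t\<bar> \<le> 1 / real (Suc n)}" by auto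
    then show ?thesis unfolding additive_derivative_set_def by (simp only: iff)
  qed
  finally show ?thesis .
qed

lemma diff_quotient_lipschitz:
  assumes "L-lipschitz_on UNIV f"
  shows "\<bar>diff_quotient f x h t - diff_quotient f x k t\<bar> \<le> L * norm (h - k)"
proof (cases "t = 0")
  case False
  have "\<bar>f (x + t *\<^sub>R h) - f (x + t *\<^sub>R k)\<bar> \<le> L * (\<bar>t\<bar> * norm (h - k))"
    using lipschitz_onD[OF assms, of "x + t *\<^sub>R h" "x + t *\<^sub>R k"]
    by (simp add: dist_norm scaleR_diff_right[symmetric])
  moreover have "\<bar>diff_quotient f x h t - diff_quotient f x k t\<bar> = \<bar>f (x + t *\<^sub>R h) - f (x + t *\<^sub>R k)\<bar> / \<bar>t\<bar>"
    using False by (simp add: diff_quotient_def diff_divide_distrib[symmetric] abs_divide)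
  ultimately have "\<bar>t\<bar> * \<bar>diff_quotient f x h t - diff_quotient f x k t\<bar> \<le> \<bar>t\<bar> * (L * norm (h - k))"
    using False by (simp add: mult_ac)
  then show ?thesis using False by simp
qed (use lipschitz_on_nonneg[OF assms] in \<open>simp add: diff_quotient_def\<close>)

text \<open>
  On each line in direction \<open>h\<close> the function is Lipschitz in one real variable.
\<close>

lemma null_along_not_directionally_differentiable:
  fixes f :: "'a::real_normed_vector \<Rightarrow> real"
  assumes lip: "L-lipschitz_on UNIV f"
  shows "null_along h (- directionally_differentiable_set f h)"
  unfolding null_along_def
proof
  fix x
  let ?g = "\<lambda>t. f (x + t *\<^sub>R h)"
  have "(L * norm h)-lipschitz_on UNIV ?g"
  proof (rule lipschitz_onI)
    fix s t :: real
    have "dist (?g s) (?g t) \<le> L * dist (x + s *\<^sub>R h) (x + t *\<^sub>R h)"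
      by (rule lipschitz_onD[OF lip]) auto
    then show "dist (?g s) (?g t) \<le> L * norm h * dist s t"
      by (simp add: dist_norm scaleR_diff_left[symmetric] mult_ac)
  qed (use lipschitz_on_nonneg[OF lip] in simp)
  then have neg: "negligible {t. \<not> (\<exists>l. ((\<lambda>s. (?g (t + s) - ?g t) / s) \<longlongrightarrow> l) (at 0))}"
    by (rule negligible_not_differentiable_lipschitz)
  have eq: "{t. x + t *\<^sub>R h \<in> - directionally_differentiable_set f h} =
      {t. \<not> (\<exists>l. ((\<lambda>s. (?g (t + s) - ?g t) / s) \<longlongrightarrow> l) (at 0))}"
    by (simp add: directionally_differentiable_set_def diff_quotient_def[abs_def] scaleR_add_left add.assoc)
  have "continuous_on UNIV f" by (rule lipschitz_on_continuous_on[OF lip])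
  then have "- directionally_differentiable_set f h \<in> sets borel"
    by (intro borel_comp directionally_differentiable_set_borel)
  then show "{t. x + t *\<^sub>R h \<in> - directionally_differentiable_set f h} \<in> null_sets lborel"
    using neg line_slice_borel negligible_borel_iff_null_sets unfolding eq[symmetric] by blast
qed

text \<open>
  Let \<open>y' = y + s h\<close>.  Then the additivity defect at \<open>y\<close> for the step \<open>s\<close> is exactly the quotient
  in direction \<open>k\<close> at \<open>y'\<close> minus the one at \<open>y\<close>.  On a set where the quotients in direction \<open>k\<close>
  agree up to \<open>2 / n\<close> for all small steps, while the defect exceeds \<open>2 / n\<close>, two points of the same
  line in direction \<open>h\<close> therefore cannot be close.  So the defect has a nonzero limit at only
  countably many points of each such line.
\<close>

lemma null_along_not_additive_derivative:
  fixes f :: "'a::real_normed_vector \<Rightarrow> real"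
  shows "null_along h (directionally_differentiable_set f h \<inter> directionally_differentiable_set f k
    \<inter> directionally_differentiable_set f (h + k) - additive_derivative_set f h k)"
  (is "null_along h ?E")
  unfolding null_along_def
proof
  fix x
  let ?y = "\<lambda>t. x + t *\<^sub>R h"
  define S where "S = (\<lambda>(i, n, m). {t. \<forall>s\<in>small_steps m.
      \<bar>diff_quotient f (?y t) k s - real_of_int i / real (Suc n)\<bar> < 1 / real (Suc n) \<and>
      2 / real (Suc n) < \<bar>additivity_defect f h k (?y t) s\<bar>})"
  have "countable (S r)" for r
  proof -
    obtain i n m where r: "r = (i, n, m)" by (cases r)
    have "inj_on (\<lambda>t. \<lfloor>t * real (Suc m)\<rfloor>) (S r)"
    proof (rule inj_onI, rule ccontr)
      fix t t' assume t: "t \<in> S r" "t' \<in> S r" and eq: "\<lfloor>t * real (Suc m)\<rfloor> = \<lfloor>t' * real (Suc m)\<rfloor>"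
        and ne: "t \<noteq> t'"
      let ?s = "t' - t"
      have "\<bar>t' * real (Suc m) - t * real (Suc m)\<bar> < 1" using eq by linarith
      then have "\<bar>?s\<bar> * real (Suc m) < 1" by (metis abs_mult abs_of_nat left_diff_distrib)
      then have s: "?s \<in> small_steps m" using ne by (simp add: small_steps_def field_simps)
      have "additivity_defect f h k (?y t) ?s = diff_quotient f (?y t') k ?s - diff_quotient f (?y t) k ?s"
        using ne by (simp add: additivity_defect_def diff_quotient_def algebra_simps diff_divide_distrib[symmetric])
      moreover have "\<bar>diff_quotient f (?y t) k ?s - real_of_int i / real (Suc n)\<bar> < 1 / real (Suc n)"
          "\<bar>diff_quotient f (?y t') k ?s - real_of_int i / real (Suc n)\<bar> < 1 / real (Suc n)"
          "2 / real (Suc n) < \<bar>additivity_defect f h k (?y t) ?s\<bar>"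
        using t s unfolding r S_def by auto
      ultimately show False by (simp add: abs_if split: if_splits)
    qed
    then show ?thesis by (rule countableI')
  qed
  then have "countable (\<Union>r. S r)" by auto
  then have "(\<Union>r. S r) \<in> null_sets lborel" by (rule countable_imp_null_set_lborel)
  moreover have "{t. ?y t \<in> ?E} \<subseteq> (\<Union>r. S r)"
  proof
    fix t assume t: "t \<in> {t. ?y t \<in> ?E}"
    then obtain a b c where lim: "(diff_quotient f (?y t) h \<longlongrightarrow> a) (at 0)"
        "(diff_quotient f (?y t) k \<longlongrightarrow> b) (at 0)" "(diff_quotient f (?y t) (h + k) \<longlongrightarrow> c) (at 0)"
      by (auto simp: directionally_differentiable_set_def)
    then have defect: "(additivity_defect f h k (?y t) \<longlongrightarrow> c - a - b) (at 0)"
      unfolding additivity_defect_def[abs_def] by (intro tendsto_intros)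
    have "c - a - b \<noteq> 0" using t defect by (auto simp: additive_derivative_set_def)
    then obtain n where n: "1 / real (Suc n) < \<bar>c - a - b\<bar> / 2"
      using ex_inverse_Suc_less[of "\<bar>c - a - b\<bar> / 2"] by auto
    let ?i = "\<lfloor>b * real (Suc n)\<rfloor>"
    have "\<bar>b * real (Suc n) - real_of_int ?i\<bar> < 1" by linarith
    moreover have "b - real_of_int ?i / real (Suc n) = (b * real (Suc n) - real_of_int ?i) / real (Suc n)"
      by (simp add: diff_divide_distrib)
    ultimately have "\<bar>b - real_of_int ?i / real (Suc n)\<bar> < 1 / real (Suc n)"
      by (simp only: abs_divide abs_of_nat divide_strict_right_mono of_nat_0_less_iff zero_less_Suc)
    moreover have "((\<lambda>s. \<bar>diff_quotient f (?y t) k s - real_of_int ?i / real (Suc n)\<bar>) \<longlongrightarrow>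
        \<bar>b - real_of_int ?i / real (Suc n)\<bar>) (at 0)"
      using lim by (intro tendsto_intros)
    ultimately have "eventually (\<lambda>s. \<bar>diff_quotient f (?y t) k s - real_of_int ?i / real (Suc n)\<bar> < 1 / real (Suc n)) (at 0)"
      by (rule order_tendstoD(2)[rotated])
    moreover have "eventually (\<lambda>s. 2 / real (Suc n) < \<bar>additivity_defect f h k (?y t) s\<bar>) (at 0)"
      using n by (intro order_tendstoD(1)[OF tendsto_rabs[OF defect]]) simp
    ultimately have "eventually (\<lambda>s. \<bar>diff_quotient f (?y t) k s - real_of_int ?i / real (Suc n)\<bar> < 1 / real (Suc n) \<and>
        2 / real (Suc n) < \<bar>additivity_defect f h k (?y t) s\<bar>) (at 0)"
      by (rule eventually_conj)
    then obtain m where "t \<in> S (?i, n, m)"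
      unfolding eventually_at_0_iff_small_steps S_def by auto
    then show "t \<in> (\<Union>r. S r)" by blast
  qed
  ultimately show "{t. ?y t \<in> ?E} \<in> null_sets lborel"
    by (meson countable_imp_null_set_lborel countable_subset \<open>countable (\<Union>r. S r)\<close>)
qed

lemma has_gateaux_derivative_iff:
  "has_gateaux_derivative f D x \<longleftrightarrow> bounded_linear D \<and> (\<forall>h. (diff_quotient f x h \<longlongrightarrow> D h) (at 0))"
  by (simp add: has_gateaux_derivative_def diff_quotient_def[abs_def])

lemma ex_dense_near:
  fixes H :: "'a::real_normed_vector set"
  assumes "closure H = UNIV" "0 < e"
  obtains h' where "h' \<in> H" "norm (h - h') < e"
proof -
  have "h \<in> closure H" using assms by simp
  then show thesis using assms(2) that by (metis closure_approachable dist_norm norm_minus_commute)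
qed

text \<open>
  The difference quotients of a Lipschitz function are equi-Lipschitz in the direction, so existence
  and additivity of directional derivatives extend from a dense set of directions to all.
\<close>

lemma gateaux_derivative_of_dense_directions:
  fixes f :: "'a::real_normed_vector \<Rightarrow> real"
  assumes lip: "L-lipschitz_on UNIV f" and dense: "closure H = UNIV"
    and dir: "\<And>h. h \<in> H \<Longrightarrow> x \<in> directionally_differentiable_set f h"
    and add: "\<And>h k. \<lbrakk>h \<in> H; k \<in> H\<rbrakk> \<Longrightarrow> x \<in> additive_derivative_set f h k"
  shows "\<exists>D. has_gateaux_derivative f D x"
proof -
  let ?Q = "diff_quotient f x"
  note QL = diff_quotient_lipschitz[OF lip, of x]
  have L: "0 \<le> L" by (rule lipschitz_on_nonneg[OF lip])
  have near: "\<exists>h'\<in>H. L * norm (h - h') < e" if "0 < e" for h e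
  proof -
    have "0 < e / (L + 1)" using that L by simp
    then obtain h' where h': "h' \<in> H" "norm (h - h') < e / (L + 1)"
      by (rule ex_dense_near[OF dense])
    have "L * norm (h - h') \<le> (L + 1) * norm (h - h')" by (simp add: mult_right_mono)
    also have "\<dots> < e" using h' L by (simp add: field_simps)
    finally show ?thesis using h' by blast
  qed
  have "\<forall>h. \<exists>l. (?Q h \<longlongrightarrow> l) (at 0)"
    unfolding convergent_at_0_iff_Cauchy
  proof (intro allI)
    fix h n
    \<comment> \<open>The tolerance is spent as a half for \<open>h'\<close> and two quarters for replacing \<open>h\<close> by \<open>h'\<close>.\<close>
    have "0 < 1 / (4 * real (Suc n))" by simp
    from near[OF this] obtain h' where h': "h' \<in> H" "L * norm (h - h') < 1 / (4 * real (Suc n))" by blast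
    have "\<exists>l. (?Q h' \<longlongrightarrow> l) (at 0)" using dir[OF h'(1)] by (simp add: directionally_differentiable_set_def)
    then obtain m where m: "\<And>s t. s \<in> small_steps m \<Longrightarrow> t \<in> small_steps m \<Longrightarrow>
        \<bar>?Q h' s - ?Q h' t\<bar> \<le> 1 / real (Suc (Suc (2 * n)))"
      unfolding convergent_at_0_iff_Cauchy by meson
    have "\<bar>?Q h s - ?Q h t\<bar> \<le> 1 / real (Suc n)" if st: "s \<in> small_steps m" "t \<in> small_steps m" for s t
    proof -
      have "1 / (2 * M) + 1 / (4 * M) + 1 / (4 * M) = 1 / M" if "0 < M" for M :: real
        using that by (simp add: field_simps)
      from this[of "real (Suc n)"]
      have "1 / real (Suc (Suc (2 * n))) + 1 / (4 * real (Suc n)) + 1 / (4 * real (Suc n)) = 1 / real (Suc n)"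
        by (simp add: algebra_simps)
      moreover have "\<bar>?Q h s - ?Q h t\<bar> \<le> a + b + b"
        if "\<bar>?Q h' s - ?Q h' t\<bar> \<le> a" "L * norm (h - h') < b" for a b
        using that QL[of h s h'] QL[of h t h'] by linarith
      ultimately show ?thesis using m[OF st] h'(2) by metis
    qed
    then show "\<exists>m. \<forall>s\<in>small_steps m. \<forall>t\<in>small_steps m. \<bar>?Q h s - ?Q h t\<bar> \<le> 1 / real (Suc n)" by blast
  qed
  from choice[OF this] obtain D where D: "\<And>h. (?Q h \<longlongrightarrow> D h) (at 0)" by blast
  have defect: "(additivity_defect f h k x \<longlongrightarrow> 0) (at 0)" for h k
  proof (rule tendstoI)
    fix e :: real assume "0 < e"
    then have "0 < e / 8" by simp
    from near[OF this] obtain h' k' where hk: "h' \<in> H" "k' \<in> H"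
      "L * norm (h - h') < e / 8" "L * norm (k - k') < e / 8" by meson
    have "norm ((h + k) - (h' + k')) \<le> norm (h - h') + norm (k - k')"
      by (metis add_diff_add norm_triangle_ineq)
    then have "L * norm ((h + k) - (h' + k')) \<le> L * (norm (h - h') + norm (k - k'))"
      using L by (rule mult_left_mono)
    then have sum: "L * norm ((h + k) - (h' + k')) < e / 4" using hk by (simp add: distrib_left)
    have "\<bar>additivity_defect f h k x t\<bar> \<le> \<bar>additivity_defect f h' k' x t\<bar> + e / 2" for t
      using QL[of "h + k" t "h' + k'"] QL[of h t h'] QL[of k t k'] hk sum
      unfolding additivity_defect_def by linarith
    moreover have "eventually (\<lambda>t. dist (additivity_defect f h' k' x t) 0 < e / 2) (at 0)"
      using add[OF hk(1,2)] \<open>0 < e\<close> by (intro tendstoD) (auto simp: additive_derivative_set_def)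
    ultimately show "eventually (\<lambda>t. dist (additivity_defect f h k x t) 0 < e) (at 0)"
      by (elim eventually_mono) (simp add: dist_real_def, smt (verit) field_sum_of_halves)
  qed
  have "D (h + k) - D h - D k = 0" for h k
  proof -
    have "(additivity_defect f h k x \<longlongrightarrow> D (h + k) - D h - D k) (at 0)"
      unfolding additivity_defect_def[abs_def] by (intro tendsto_intros D)
    then show ?thesis using defect LIM_unique by blast
  qed
  then have D_add: "D (h + k) = D h + D k" for h k by (metis add_diff_cancel_left' diff_eq_diff_eq diff_0_right diff_diff_eq)
  have D_scale: "D (c *\<^sub>R h) = c * D h" for c h
  proof (cases "c = 0")
    case True
    have "D 0 = 0" using D_add[of 0 0] by simp
    then show ?thesis using True by simp
  next
    case False
    have "filterlim (\<lambda>t. c * t) (at 0) (at (0::real))"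
      using False by (auto simp: filterlim_at eventually_at intro!: tendsto_eq_intros exI[of _ 1])
    from filterlim_compose[OF D this] have "((\<lambda>t. c * ?Q h (c * t)) \<longlongrightarrow> c * D h) (at 0)"
      by (intro tendsto_intros)
    moreover have "c * ?Q h (c * t) = ?Q (c *\<^sub>R h) t" for t
      using False by (simp add: diff_quotient_def mult.commute)
    ultimately show ?thesis using LIM_unique D by (metis (no_types, lifting) ext)
  qed
  have D_bound: "\<bar>D h\<bar> \<le> norm h * L" for h
  proof (rule tendsto_upperbound[OF tendsto_rabs[OF D]])
    show "eventually (\<lambda>t. \<bar>?Q h t\<bar> \<le> norm h * L) (at 0)"
      using QL[of h _ 0] by (simp add: diff_quotient_def mult.commute)
  qed simp
  have "bounded_linear D"
    by (rule bounded_linear_intro[where K = L]) (use D_add D_scale D_bound in auto)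
  then show ?thesis using D unfolding has_gateaux_derivative_iff by blast
qed

text \<open>
  Aronszajn's version of Rademacher's theorem.  The exceptional set is the same for every dense set
  \<open>H\<close> of directions.  A countable \<open>H\<close> shows that it is Borel, and for a given sequence \<open>\<xi>\<close> a
  countable dense \<open>H\<close> inside the span of \<open>\<xi>\<close> shows that it decomposes along \<open>\<xi>\<close>.
\<close>

theorem lipschitz_gateaux_differentiable_off_null:
  fixes f :: "'a::{real_normed_vector, second_countable_topology} \<Rightarrow> real"
  assumes lip: "L-lipschitz_on UNIV f"
  shows "strictly_aronszajn_null {x. \<not> (\<exists>D. has_gateaux_derivative f D x)}"
proof -
  let ?N = "{x. \<not> (\<exists>D. has_gateaux_derivative f D x)}"
  have cont: "continuous_on UNIV f" by (rule lipschitz_on_continuous_on[OF lip])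
  let ?E = "\<lambda>h. - directionally_differentiable_set f h"
  let ?A = "\<lambda>h k. directionally_differentiable_set f h \<inter> directionally_differentiable_set f k
    \<inter> directionally_differentiable_set f (h + k) - additive_derivative_set f h k"
  have borel: "?E h \<in> sets borel" "?A h k \<in> sets borel" for h k
    using directionally_differentiable_set_borel[OF cont] additive_derivative_set_borel[OF cont]
    by (auto intro!: borel_comp)
  have N_eq: "?N = (\<Union>h\<in>H. ?E h) \<union> (\<Union>h\<in>H. \<Union>k\<in>H. ?E (h + k) \<union> ?A h k)" if H: "closure H = UNIV" for H
  proof (intro equalityI subsetI)
    fix x assume "x \<in> ?N"
    then obtain h k where "h \<in> H" "k \<in> H"
      "x \<in> ?E h \<or> x \<notin> additive_derivative_set f h k"
      using gateaux_derivative_of_dense_directions[OF lip H, of x] by blast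
    then show "x \<in> (\<Union>h\<in>H. ?E h) \<union> (\<Union>h\<in>H. \<Union>k\<in>H. ?E (h + k) \<union> ?A h k)" by blast
  next
    fix x assume x: "x \<in> (\<Union>h\<in>H. ?E h) \<union> (\<Union>h\<in>H. \<Union>k\<in>H. ?E (h + k) \<union> ?A h k)"
    show "x \<in> ?N"
    proof (rule ccontr)
      assume "x \<notin> ?N"
      then obtain D where D: "bounded_linear D" "\<And>h. (diff_quotient f x h \<longlongrightarrow> D h) (at 0)"
        by (auto simp: has_gateaux_derivative_iff)
      then have "x \<in> directionally_differentiable_set f h" for h
        by (auto simp: directionally_differentiable_set_def)
      moreover have "x \<in> additive_derivative_set f h k" for h k
      proof -
        have "(additivity_defect f h k x \<longlongrightarrow> D (h + k) - D h - D k) (at 0)"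
          unfolding additivity_defect_def[abs_def] by (intro tendsto_intros D)
        moreover have "D (h + k) = D h + D k" by (rule linear_add[OF bounded_linear.linear[OF D(1)]])
        ultimately show ?thesis by (simp add: additive_derivative_set_def)
      qed
      ultimately show False using x by blast
    qed
  qed
  have N_borel: "?N \<in> sets borel"
  proof -
    obtain H :: "'a set" where H: "countable H" "closure UNIV \<subseteq> closure H"
      using countable_dense_subset[of UNIV] by metis
    then have cl: "closure H = UNIV" by auto
    show ?thesis
      unfolding N_eq[OF cl] using H(1) borel by (intro sets.Un sets.countable_UN') auto
  qed
  moreover have "decomposes_along \<xi> ?N" if \<xi>: "closure (span (range \<xi>)) = UNIV" for \<xi> :: "nat \<Rightarrow> 'a"
  proof -
    obtain H where H: "countable H" "H \<subseteq> span (range \<xi>)" "closure (span (range \<xi>)) \<subseteq> closure H"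
      using countable_dense_subset by metis
    then have cl: "closure H = UNIV" using \<xi> by auto
    have dE: "decomposes_along \<xi> (?E h)" if "h \<in> span (range \<xi>)" for h
      using that borel null_along_not_directionally_differentiable[OF lip]
      by (intro decomposes_along_of_null_along_span)
    have dA: "decomposes_along \<xi> (?A h k)" if "h \<in> span (range \<xi>)" for h k
      using that borel null_along_not_additive_derivative
      by (intro decomposes_along_of_null_along_span)
    have "h + k \<in> span (range \<xi>)" if "h \<in> H" "k \<in> H" for h k
      using that H(2) by (auto intro: span_add)
    then show ?thesis
      unfolding N_eq[OF cl] using H
      by (intro decomposes_along_Un decomposes_along_UN dE dA) auto
  qed
  ultimately show ?thesis unfolding strictly_aronszajn_null_def by blast
qed

section \<open>Hadamard differentiability at pointwise Lipschitz points\<close>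

definition has_hadamard_derivative ::
    "('a::real_normed_vector \<Rightarrow> real) \<Rightarrow> ('a \<Rightarrow> real) \<Rightarrow> 'a \<Rightarrow> bool" where
  "has_hadamard_derivative f D x \<longleftrightarrow> bounded_linear D \<and>
    (\<forall>K. compact K \<longrightarrow> uniform_limit K (\<lambda>t h. diff_quotient f x h t) D (at 0))"

lemma has_hadamard_derivative_imp_gateaux:
  assumes "has_hadamard_derivative f D x"
  shows "has_gateaux_derivative f D x"
proof -
  have "(diff_quotient f x h \<longlongrightarrow> D h) (at 0)" for h
  proof -
    have "compact {h}" by simp
    then have "uniform_limit {h} (\<lambda>t h. diff_quotient f x h t) D (at 0)"
      using assms unfolding has_hadamard_derivative_def by blast
    from tendsto_uniform_limitI[OF this, of h] show ?thesis by simp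
  qed
  then show ?thesis
    using assms unfolding has_gateaux_derivative_iff has_hadamard_derivative_def by blast
qed

lemma hadamard_differentiable_at_iff:
  "hadamard_differentiable_at f x \<longleftrightarrow> (\<exists>D. has_hadamard_derivative f D x)"
proof
  assume "hadamard_differentiable_at f x"
  then show "\<exists>D. has_hadamard_derivative f D x"
    unfolding hadamard_differentiable_at_def has_hadamard_derivative_def has_gateaux_derivative_def
      diff_quotient_def by blast
next
  assume "\<exists>D. has_hadamard_derivative f D x"
  then obtain D where D: "has_hadamard_derivative f D x" ..
  have "has_gateaux_derivative f D x" by (rule has_hadamard_derivative_imp_gateaux[OF D])
  then show "hadamard_differentiable_at f x"
    using D unfolding hadamard_differentiable_at_def has_hadamard_derivative_def diff_quotient_def by blast
qed

text \<open>
  Equi-Lipschitz quotients that converge on a finite net of \<open>K\<close> converge uniformly up to the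
  mesh of the net.
\<close>

lemma lipschitz_gateaux_imp_hadamard:
  fixes f :: "'a::real_normed_vector \<Rightarrow> real"
  assumes lip: "L-lipschitz_on UNIV f" and gat: "has_gateaux_derivative f D x"
  shows "has_hadamard_derivative f D x"
  unfolding has_hadamard_derivative_def
proof (intro conjI allI impI)
  let ?Q = "diff_quotient f x"
  note QL = diff_quotient_lipschitz[OF lip, of x]
  have L: "0 \<le> L" by (rule lipschitz_on_nonneg[OF lip])
  have lim: "(?Q h \<longlongrightarrow> D h) (at 0)" for h using gat by (simp add: has_gateaux_derivative_iff)
  have DL: "\<bar>D h - D k\<bar> \<le> L * norm (h - k)" for h k
    by (rule tendsto_upperbound[OF tendsto_rabs[OF tendsto_diff[OF lim lim]]]) (use QL in auto)
  fix K :: "'a set" assume K: "compact K"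
  show "uniform_limit K (\<lambda>t h. ?Q h t) D (at 0)"
  proof (rule uniform_limitI)
    fix e :: real assume e: "0 < e"
    let ?r = "e / (3 * (L + 1))"
    have r: "0 < ?r" using e L by simp
    obtain F where F: "finite F" "K \<subseteq> (\<Union>h\<in>F. ball h ?r)"
      using K r unfolding compact_eq_totally_bounded by meson
    have "eventually (\<lambda>t. dist (?Q h t) (D h) < e / 3) (at 0)" for h
      using lim by (rule tendstoD) (use e in simp)
    then have "eventually (\<lambda>t. \<forall>h\<in>F. dist (?Q h t) (D h) < e / 3) (at 0)"
      using F(1) by (simp add: eventually_ball_finite)
    then show "eventually (\<lambda>t. \<forall>h\<in>K. dist (?Q h t) (D h) < e) (at 0)"
    proof (elim eventually_mono, intro ballI)
      fix t h assume t: "\<forall>h\<in>F. dist (?Q h t) (D h) < e / 3" and "h \<in> K"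
      then obtain k where k: "k \<in> F" "norm (h - k) < ?r"
        using F(2) by (auto simp: dist_norm norm_minus_commute)
      have "L * norm (h - k) \<le> L * ?r" using k L by (intro mult_left_mono) auto
      also have "\<dots> \<le> e / 3" using e L by (simp add: field_simps)
      finally have "L * norm (h - k) \<le> e / 3" .
      moreover have "\<bar>?Q k t - D k\<bar> < e / 3" using t k by (simp add: dist_real_def)
      ultimately show "dist (?Q h t) (D h) < e"
        using QL[of h t k] DL[of h k] unfolding dist_real_def by linarith
    qed
  qed
qed (use gat in \<open>simp add: has_gateaux_derivative_iff\<close>)

text \<open>
  The difference of the two derivatives is a linear functional that is nonnegative everywhere,
  hence zero, and the quotients of \<open>f\<close> lie between those of \<open>u\<close> and \<open>v\<close>.
\<close>

lemma hadamard_differentiable_sandwich: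
  fixes f u v :: "'a::real_normed_vector \<Rightarrow> real"
  assumes r: "0 < r" and between: "\<And>y. y \<in> ball x r \<Longrightarrow> u y \<le> f y \<and> f y \<le> v y"
    and eq: "u x = f x" "v x = f x"
    and u: "has_hadamard_derivative u D x" and v: "has_hadamard_derivative v D' x"
  shows "hadamard_differentiable_at f x"
proof -
  have lin: "linear D" "linear D'"
    using u v by (auto simp: has_hadamard_derivative_def intro: bounded_linear.linear)
  have lim: "(diff_quotient u x h \<longlongrightarrow> D h) (at 0)" "(diff_quotient v x h \<longlongrightarrow> D' h) (at 0)" for h
    using u v by (auto dest!: has_hadamard_derivative_imp_gateaux simp: has_gateaux_derivative_iff)
  have D_le: "D h \<le> D' h" for h
  proof -
    have "((\<lambda>t. x + t *\<^sub>R h) \<longlongrightarrow> x) (at_right 0)" by (auto intro!: tendsto_eq_intros)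
    then have "eventually (\<lambda>t. x + t *\<^sub>R h \<in> ball x r) (at_right 0)"
      using tendstoD[OF _ r] by (simp add: dist_commute)
    then have ev: "eventually (\<lambda>t. diff_quotient u x h t \<le> diff_quotient v x h t) (at_right 0)"
      using eventually_at_right_less[of 0]
    proof eventually_elim
      case (elim t)
      then have "u (x + t *\<^sub>R h) \<le> v (x + t *\<^sub>R h)" using between by fastforce
      then show ?case using elim eq by (simp add: diff_quotient_def divide_right_mono)
    qed
    have "at_right (0::real) \<le> at 0" by (rule at_le) simp
    then show ?thesis
      using tendsto_le[OF _ tendsto_mono[OF _ lim(2)] tendsto_mono[OF _ lim(1)] ev] by simp
  qed
  have D_eq: "D' = D"
  proof
    fix h
    have "D (- h) \<le> D' (- h)" by (rule D_le)
    then have "D' h \<le> D h" using lin by (simp add: linear_neg)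
    then show "D' h = D h" using D_le[of h] by simp
  qed
  have "uniform_limit K (\<lambda>t h. diff_quotient f x h t) D (at 0)" if K: "compact K" for K
  proof (rule uniform_limitI)
    fix e :: real assume e: "0 < e"
    obtain B where B: "0 < B" "\<And>h. h \<in> K \<Longrightarrow> norm h \<le> B"
      using compact_imp_bounded[OF K] by (auto simp: bounded_pos)
    have "eventually (\<lambda>t. \<forall>h\<in>K. dist (diff_quotient u x h t) (D h) < e) (at 0)"
      "eventually (\<lambda>t. \<forall>h\<in>K. dist (diff_quotient v x h t) (D h) < e) (at 0)"
      using u v K e unfolding D_eq has_hadamard_derivative_def by (auto dest!: spec[of _ K] intro: uniform_limitD)
    moreover have "eventually (\<lambda>t. \<bar>t\<bar> < r / B) (at (0::real))"
      unfolding eventually_at using r B by (intro exI[of _ "r / B"]) (auto simp: dist_real_def)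
    moreover have "eventually (\<lambda>t. t \<noteq> 0) (at (0::real))" by (simp add: eventually_at_filter)
    ultimately show "eventually (\<lambda>t. \<forall>h\<in>K. dist (diff_quotient f x h t) (D h) < e) (at 0)"
    proof eventually_elim
      case (elim t)
      show ?case
      proof
        fix h assume h: "h \<in> K"
        have "\<bar>t\<bar> * norm h \<le> \<bar>t\<bar> * B" using B(2)[OF h] by (simp add: mult_left_mono)
        also have "\<dots> < r" using elim B by (simp add: field_simps)
        finally have "x + t *\<^sub>R h \<in> ball x r" by (simp add: dist_norm)
        then have *: "u (x + t *\<^sub>R h) \<le> f (x + t *\<^sub>R h)" "f (x + t *\<^sub>R h) \<le> v (x + t *\<^sub>R h)"
          using between by auto
        have "min (diff_quotient u x h t) (diff_quotient v x h t) \<le> diff_quotient f x h t \<and>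
            diff_quotient f x h t \<le> max (diff_quotient u x h t) (diff_quotient v x h t)"
          using * eq \<open>t \<noteq> 0\<close> unfolding diff_quotient_def
          by (cases "0 < t") (auto simp: divide_right_mono divide_right_mono_neg min_le_iff_disj le_max_iff_disj)
        moreover have "\<bar>diff_quotient u x h t - D h\<bar> < e" "\<bar>diff_quotient v x h t - D h\<bar> < e"
          using elim h by (auto simp: dist_real_def)
        ultimately show "dist (diff_quotient f x h t) (D h) < e"
          unfolding dist_real_def by linarith
      qed
    qed
  qed
  then have "has_hadamard_derivative f D x"
    using u by (simp add: has_hadamard_derivative_def)
  then show ?thesis unfolding hadamard_differentiable_at_iff by blast
qed

text \<open>
  The least Lipschitz extension in McShane's formula.  The last conclusion says that \<open>u\<close> is the
  least upper bound of the cones below the graph, which is how \<open>u\<close> is compared with \<open>f\<close> off \<open>S\<close>.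
\<close>

lemma lipschitz_lower_envelope:
  fixes f :: "'a::metric_space \<Rightarrow> real"
  assumes S: "S \<noteq> {}" and L: "0 \<le> L" and lip: "\<And>x y. \<lbrakk>x \<in> S; y \<in> S\<rbrakk> \<Longrightarrow> \<bar>f x - f y\<bar> \<le> L * dist x y"
  obtains u where "L-lipschitz_on UNIV u" "\<And>x. x \<in> S \<Longrightarrow> u x = f x"
    "\<And>y c. (\<And>x. x \<in> S \<Longrightarrow> f x - L * dist y x \<le> c) \<Longrightarrow> u y \<le> c"
proof -
  define u where "u y = (SUP x\<in>S. f x - L * dist y x)" for y
  have bdd: "bdd_above ((\<lambda>x. f x - L * dist y x) ` S)" for y
  proof -
    obtain s where s: "s \<in> S" using S by blast
    have "f x - L * dist y x \<le> f s + L * dist y s" if x: "x \<in> S" for x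
    proof -
      have "L * dist x s \<le> L * (dist y x + dist y s)"
        using L by (intro mult_left_mono) (auto simp: dist_triangle3)
      then show ?thesis using lip[OF x s] by (simp add: distrib_left)
    qed
    then show ?thesis by (rule bdd_aboveI2)
  qed
  have upper: "u y \<le> c" if "\<And>x. x \<in> S \<Longrightarrow> f x - L * dist y x \<le> c" for y c
    unfolding u_def using that S by (intro cSUP_least)
  have lower: "f x - L * dist y x \<le> u y" if "x \<in> S" for x y
    unfolding u_def using that bdd by (intro cSUP_upper)
  show thesis
  proof (rule that[OF _ _ upper])
    have one: "u y - u z \<le> L * dist y z" for y z
    proof -
      have "u y \<le> u z + L * dist y z"
      proof (rule upper)
        fix x assume x: "x \<in> S"
        have "L * dist z x \<le> L * (dist y z + dist y x)"
          by (rule mult_left_mono[OF dist_triangle3 L])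
        then show "f x - L * dist y x \<le> u z + L * dist y z"
          using lower[OF x, of z] by (simp add: distrib_left)
      qed
      then show ?thesis by simp
    qed
    show "L-lipschitz_on UNIV u"
    proof (rule lipschitz_onI)
      fix y z show "dist (u y) (u z) \<le> L * dist y z"
        using one[of y z] one[of z y] by (simp add: dist_real_def dist_commute abs_le_iff)
    qed (rule L)
    fix x assume x: "x \<in> S"
    have "u x \<le> f x"
    proof (rule upper)
      fix s assume "s \<in> S"
      then show "f s - L * dist x s \<le> f x" using lip[OF _ x, of s] by (simp add: dist_commute)
    qed
    then show "u x = f x" using lower[OF x, of x] by simp
  qed
qed

text \<open>
  Stepanov's theorem, by an argument of Maly.  In a small ball the function lies between the lower
  and the upper Lipschitz envelope of its restriction to \<open>lip_points f n\<close> inside the ball, and all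
  three agree on this set.  At its points where both envelopes are differentiable, so is \<open>f\<close>.
\<close>

theorem stepanov_hadamard:
  fixes f :: "'a::{real_normed_vector, second_countable_topology} \<Rightarrow> real"
  shows "\<exists>N. strictly_aronszajn_null N \<and> (\<forall>x\<in>pointwise_lipschitz_set f - N. hadamard_differentiable_at f x)"
proof -
  obtain H :: "'a set" where H: "countable H" "closure UNIV \<subseteq> closure H"
    using countable_dense_subset[of UNIV] by metis
  then have dense: "closure H = UNIV" by auto
  let ?b = "\<lambda>n c. ball c (1 / (2 * real (Suc n)))"
  define S where "S n c = lip_points f n \<inter> ?b n c" for n c
  have "\<exists>N. strictly_aronszajn_null N \<and> (\<forall>x\<in>S n c - N. hadamard_differentiable_at f x)" for n c
  proof (cases "S n c = {}")
    case True
    have "decomposes_along \<xi> {}" for \<xi> :: "nat \<Rightarrow> 'a" by (rule decomposes_along_empty)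
    then show ?thesis using True by (intro exI[of _ "{}"]) (auto simp: strictly_aronszajn_null_def)
  next
    case False
    let ?L = "real (Suc n)"
    have close: "\<bar>f y - f x\<bar> \<le> ?L * dist y x" if x: "x \<in> S n c" and y: "y \<in> ?b n c" for x y
    proof -
      have "dist y x \<le> dist c y + dist c x" by (rule dist_triangle3)
      also have "\<dots> < 1 / (2 * ?L) + 1 / (2 * ?L)"
        using x y by (intro add_strict_mono) (auto simp: S_def)
      also have "\<dots> = 1 / ?L" by (simp add: field_simps)
      finally show ?thesis using x by (simp add: S_def lip_points_def)
    qed
    have lip: "\<bar>f x - f y\<bar> \<le> ?L * dist x y" if "x \<in> S n c" "y \<in> S n c" for x y
      using close that by (auto simp: S_def)
    then have lip': "\<bar>(- f x) - (- f y)\<bar> \<le> ?L * dist x y" if "x \<in> S n c" "y \<in> S n c" for x y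
      using that by (simp add: abs_minus_commute)
    obtain u where u: "?L-lipschitz_on UNIV u" "\<And>x. x \<in> S n c \<Longrightarrow> u x = f x"
        "\<And>y a. (\<And>x. x \<in> S n c \<Longrightarrow> f x - ?L * dist y x \<le> a) \<Longrightarrow> u y \<le> a"
      using lipschitz_lower_envelope[OF False _ lip] by (metis of_nat_0_le_iff)
    obtain w where w: "?L-lipschitz_on UNIV w" "\<And>x. x \<in> S n c \<Longrightarrow> w x = - f x"
        "\<And>y a. (\<And>x. x \<in> S n c \<Longrightarrow> - f x - ?L * dist y x \<le> a) \<Longrightarrow> w y \<le> a"
      using lipschitz_lower_envelope[OF False _ lip'] by (metis of_nat_0_le_iff)
    have v: "?L-lipschitz_on UNIV (\<lambda>y. - w y)" using w(1) by (simp add: lipschitz_on_minus)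
    let ?N = "{x. \<not> (\<exists>D. has_gateaux_derivative u D x)} \<union> {x. \<not> (\<exists>D. has_gateaux_derivative (\<lambda>y. - w y) D x)}"
    have "strictly_aronszajn_null ?N"
      by (intro strictly_aronszajn_null_Un lipschitz_gateaux_differentiable_off_null[OF u(1)]
          lipschitz_gateaux_differentiable_off_null[OF v])
    moreover have "hadamard_differentiable_at f x" if x: "x \<in> S n c - ?N" for x
    proof -
      obtain D D' where D: "has_hadamard_derivative u D x" "has_hadamard_derivative (\<lambda>y. - w y) D' x"
        using x lipschitz_gateaux_imp_hadamard[OF u(1)] lipschitz_gateaux_imp_hadamard[OF v] by blast
      have "x \<in> ?b n c" using x by (simp add: S_def)
      then obtain r where r: "0 < r" "ball x r \<subseteq> ?b n c" using openE[OF open_ball] by blast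
      have "u y \<le> f y \<and> f y \<le> - w y" if "y \<in> ball x r" for y
      proof
        have y: "y \<in> ?b n c" using that r by blast
        show "u y \<le> f y" by (rule u(3)) (use close[OF _ y] in force)
        have "w y \<le> - f y" by (rule w(3)) (use close[OF _ y] in force)
        then show "f y \<le> - w y" by simp
      qed
      then show ?thesis
        using D x u(2) w(2) by (intro hadamard_differentiable_sandwich[OF r(1) _ _ _ D]) auto
    qed
    ultimately show ?thesis by blast
  qed
  then obtain N where N: "\<And>n c. strictly_aronszajn_null (N n c)"
    "\<And>n c x. x \<in> S n c - N n c \<Longrightarrow> hadamard_differentiable_at f x"
    by metis
  have "hadamard_differentiable_at f x" if x: "x \<in> pointwise_lipschitz_set f - (\<Union>n. \<Union>c\<in>H. N n c)" for x
  proof -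
    obtain n where n: "x \<in> lip_points f n" using x by (auto simp: pointwise_lipschitz_set_def)
    obtain c where c: "c \<in> H" "norm (x - c) < 1 / (2 * real (Suc n))"
      by (rule ex_dense_near[OF dense, of "1 / (2 * real (Suc n))" x]) auto
    have "x \<in> S n c" using n c by (simp add: S_def dist_norm norm_minus_commute)
    then show ?thesis using N(2)[of x n c] x c by blast
  qed
  moreover have "strictly_aronszajn_null (\<Union>n. \<Union>c\<in>H. N n c)"
    using H(1) N(1) by (intro strictly_aronszajn_null_UN) auto
  ultimately show ?thesis by blast
qed

section \<open>Functions monotone along a cone\<close>

text \<open>
  The Lipschitz estimate at the points \<open>x k\<close>, applied with the limit point as second point,
  forces \<open>f (x k)\<close> to converge to the value at the limit, although \<open>f\<close> may be discontinuous
  elsewhere.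
\<close>

lemma lip_points_closed: "closed (lip_points f n)"
  unfolding closed_sequential_limits
proof (intro allI impI, elim conjE)
  fix x l assume x: "\<forall>k. x k \<in> lip_points f n" and lim: "x \<longlonglongrightarrow> l"
  let ?L = "real (Suc n)"
  have bound: "eventually (\<lambda>k. \<bar>f y - f (x k)\<bar> \<le> ?L * dist y (x k)) sequentially"
    if "dist y l < 1 / ?L" for y
  proof -
    have "(\<lambda>k. dist y (x k)) \<longlonglongrightarrow> dist y l" by (intro tendsto_intros lim)
    then have "eventually (\<lambda>k. dist y (x k) < 1 / ?L) sequentially"
      using that by (rule order_tendstoD(2))
    then show ?thesis using x by (auto simp: lip_points_def elim!: eventually_mono)
  qed
  have dist_l: "(\<lambda>k. ?L * dist l (x k)) \<longlonglongrightarrow> 0"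
    by (rule tendsto_eq_intros lim | simp)+
  have "(\<lambda>k. f l - f (x k)) \<longlonglongrightarrow> 0"
    using bound[of l] by (intro tendsto_rabs_zero_cancel[OF tendsto_sandwich[OF _ _ tendsto_const dist_l]]) auto
  then have f_lim: "(\<lambda>k. f (x k)) \<longlonglongrightarrow> f l"
    using tendsto_diff[OF tendsto_const[of "f l"]] by fastforce
  have "\<bar>f y - f l\<bar> \<le> ?L * dist y l" if "dist y l < 1 / ?L" for y
  proof (rule tendsto_le)
    show "(\<lambda>k. ?L * dist y (x k)) \<longlonglongrightarrow> ?L * dist y l" by (intro tendsto_intros lim)
    show "(\<lambda>k. \<bar>f y - f (x k)\<bar>) \<longlonglongrightarrow> \<bar>f y - f l\<bar>" by (intro tendsto_intros f_lim)
  qed (use bound[OF that] in auto)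
  then show "l \<in> lip_points f n" by (simp add: lip_points_def)
qed

lemma pointwise_lipschitz_set_borel: "pointwise_lipschitz_set f \<in> sets borel"
  unfolding pointwise_lipschitz_set_def by (intro sets.countable_UN') (auto intro: borel_closed lip_points_closed)

text \<open>
  Near \<open>x\<close> the function increases along the open convex cone spanned by the ball around \<open>v\<close>, with the
  starting point confined to a neighbourhood of \<open>x\<close> but not the end point.
\<close>

definition locally_cone_monotone_at :: "('a::real_normed_vector \<Rightarrow> real) \<Rightarrow> 'a \<Rightarrow> bool" where
  "locally_cone_monotone_at f x \<longleftrightarrow> (\<exists>v r e. 0 < r \<and> 0 < e \<and>
    (\<forall>y\<in>ball x r. \<forall>d\<in>ball v e. \<forall>t\<ge>0. f y \<le> f (y + t *\<^sub>R d)))"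

text \<open>
  If \<open>z\<close> is close to \<open>y = x + t e\<close> and \<open>\<tau>\<close> is the right multiple of the distance of \<open>z\<close> from \<open>y\<close>,
  then \<open>y - \<tau> e \<le> z \<le> y + \<tau> e\<close> in the order of the cone.  So the oscillation of \<open>f\<close> near \<open>y\<close> is
  controlled by its oscillation on the line in direction \<open>e\<close>.
\<close>

lemma pointwise_lipschitz_of_line:
  fixes f :: "'a::real_normed_vector \<Rightarrow> real"
  assumes mono: "\<And>y d t. \<lbrakk>y \<in> ball x0 r; d \<in> ball v \<eta>; 0 \<le> t\<rbrakk> \<Longrightarrow> f y \<le> f (y + t *\<^sub>R d)"
    and \<eta>: "0 < \<eta>" and e: "e \<in> ball v (\<eta> / 2)" and y: "x + t *\<^sub>R e \<in> ball x0 r"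
    and line: "t \<in> pointwise_lipschitz_set (\<lambda>s. f (x + s *\<^sub>R e))"
  shows "x + t *\<^sub>R e \<in> pointwise_lipschitz_set f"
proof -
  let ?y = "x + t *\<^sub>R e"
  obtain n where n: "\<And>s. dist s t < 1 / real (Suc n) \<Longrightarrow>
      \<bar>f (x + s *\<^sub>R e) - f ?y\<bar> \<le> real (Suc n) * dist s t"
    using line by (auto simp: pointwise_lipschitz_set_def lip_points_def)
  obtain \<rho> where \<rho>: "0 < \<rho>" "ball ?y \<rho> \<subseteq> ball x0 r" using openE[OF open_ball y] by blast
  \<comment> \<open>For \<open>z\<close> within \<open>\<epsilon>\<close> of \<open>?y\<close>, both \<open>z\<close> and \<open>?y - \<tau> e\<close> stay in the ball, where monotonicity
    may start, and \<open>\<tau>\<close> is a step for which the bound on the line holds.\<close>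
  define \<epsilon> where "\<epsilon> = min \<rho> (\<eta> / 2 * min (1 / real (Suc n)) (\<rho> / (norm e + 1)))"
  have "0 < \<rho> / (norm e + 1)" using \<rho> by (intro divide_pos_pos add_nonneg_pos) auto
  then have \<epsilon>: "0 < \<epsilon>" using \<rho> \<eta> by (auto simp: \<epsilon>_def intro!: mult_pos_pos)
  show ?thesis
  proof (rule pointwise_lipschitz_setI[OF \<epsilon>])
    fix z assume z: "dist z ?y < \<epsilon>"
    \<comment> \<open>This makes \<open>z - ?y\<close> equal to \<open>\<tau>\<close> times a vector of norm \<open>\<eta> / 2\<close>.\<close>
    define \<tau> where "\<tau> = 2 * dist z ?y / \<eta>"
    show "\<bar>f z - f ?y\<bar> \<le> (2 * real (Suc n) / \<eta>) * dist z ?y"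
    proof (cases "z = ?y")
      case False
      then have \<tau>_pos: "0 < \<tau>" using \<eta> by (simp add: \<tau>_def)
      have "dist z ?y < \<eta> / 2 * min (1 / real (Suc n)) (\<rho> / (norm e + 1))"
        using z by (simp add: \<epsilon>_def)
      then have "\<tau> < min (1 / real (Suc n)) (\<rho> / (norm e + 1))"
        using \<eta> by (simp add: \<tau>_def field_simps del: min_less_iff_conj)
      then have \<tau>: "\<tau> < 1 / real (Suc n)" "\<tau> < \<rho> / (norm e + 1)" by auto
      define k where "k = (1 / \<tau>) *\<^sub>R (z - ?y)"
      have zk: "z = ?y + \<tau> *\<^sub>R k" using \<tau>_pos by (simp add: k_def)
      have "norm k = dist z ?y / \<tau>" using \<tau>_pos by (simp only: k_def norm_scaleR dist_norm) simp
      then have "norm k = \<eta> / 2" using False \<eta> by (simp add: \<tau>_def)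
      moreover have "dist v (e + k) \<le> norm (v - e) + norm k" "dist v (e - k) \<le> norm (v - e) + norm k"
        using norm_triangle_ineq4[of "v - e" k] norm_triangle_ineq[of "v - e" k]
        by (simp_all add: dist_norm algebra_simps)
      ultimately have cone: "e + k \<in> ball v \<eta>" "e - k \<in> ball v \<eta>"
        using e by (auto simp: dist_norm)
      have "\<tau> * norm e \<le> \<tau> * (norm e + 1)" using \<tau>_pos by simp
      also have "\<dots> < \<rho>" using \<tau>(2) by (simp add: pos_less_divide_eq add_nonneg_pos)
      finally have "?y - \<tau> *\<^sub>R e \<in> ball ?y \<rho>" using \<tau>_pos by (simp add: dist_norm)
      then have "?y - \<tau> *\<^sub>R e \<in> ball x0 r" using \<rho> by blast
      from mono[OF this cone(1), of \<tau>] have lower: "f (?y - \<tau> *\<^sub>R e) \<le> f z"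
        using \<tau>_pos by (simp add: zk algebra_simps)
      have "z \<in> ball ?y \<rho>" using z by (simp add: \<epsilon>_def dist_commute)
      then have "z \<in> ball x0 r" using \<rho> by blast
      from mono[OF this cone(2), of \<tau>] have upper: "f z \<le> f (?y + \<tau> *\<^sub>R e)"
        using \<tau>_pos by (simp add: zk algebra_simps)
      have shift: "x + (t - \<tau>) *\<^sub>R e = ?y - \<tau> *\<^sub>R e" "x + (t + \<tau>) *\<^sub>R e = ?y + \<tau> *\<^sub>R e"
        by (simp_all add: algebra_simps)
      have "\<bar>f (?y - \<tau> *\<^sub>R e) - f ?y\<bar> \<le> real (Suc n) * \<tau>" "\<bar>f (?y + \<tau> *\<^sub>R e) - f ?y\<bar> \<le> real (Suc n) * \<tau>"
        using n[of "t - \<tau>"] n[of "t + \<tau>"] \<tau>(1) \<tau>_pos unfolding shift by (auto simp: dist_real_def)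
      then have "\<bar>f z - f ?y\<bar> \<le> real (Suc n) * \<tau>" using lower upper by linarith
      also have "\<dots> = (2 * real (Suc n) / \<eta>) * dist z ?y" by (simp add: \<tau>_def)
      finally show ?thesis .
    qed simp
  qed
qed

text \<open>
  On a line in a direction of the cone \<open>f\<close> is monotone, hence almost everywhere pointwise Lipschitz as
  a function of one variable.  The part of the line inside the ball is exhausted by intervals with rational end points.
\<close>

lemma null_along_not_pointwise_lipschitz:
  fixes f :: "'a::real_normed_vector \<Rightarrow> real"
  assumes mono: "\<And>y d t. \<lbrakk>y \<in> ball x0 r; d \<in> ball v \<eta>; 0 \<le> t\<rbrakk> \<Longrightarrow> f y \<le> f (y + t *\<^sub>R d)"
    and \<eta>: "0 < \<eta>" and e: "e \<in> ball v (\<eta> / 2)"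
  shows "null_along e (ball x0 r - pointwise_lipschitz_set f)"
  unfolding null_along_def
proof
  fix x
  let ?g = "\<lambda>s. f (x + s *\<^sub>R e)"
  let ?J = "{t. x + t *\<^sub>R e \<in> ball x0 r}"
  let ?B = "ball x0 r - pointwise_lipschitz_set f"
  let ?R = "{(c, d). c \<in> \<rat> \<and> d \<in> \<rat> \<and> {c..d} \<subseteq> ?J}"
  have "e \<in> ball v \<eta>" using e \<eta> by auto
  then have g_mono: "mono_on {c..d} ?g" if "{c..d} \<subseteq> ?J" for c d
  proof (intro mono_onI)
    fix s t assume st: "s \<in> {c..d}" "t \<in> {c..d}" "s \<le> t"
    then have "x + s *\<^sub>R e \<in> ball x0 r" using that by blast
    from mono[OF this \<open>e \<in> ball v \<eta>\<close>, of "t - s"] show "?g s \<le> ?g t"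
      using st(3) by (simp add: algebra_simps)
  qed
  have J_open: "open ?J"
  proof -
    have "open ((\<lambda>t. x + t *\<^sub>R e) -` ball x0 r)"
      by (intro open_vimage continuous_intros) auto
    then show ?thesis by (simp add: vimage_def)
  qed
  have "{t. x + t *\<^sub>R e \<in> ?B} \<subseteq> (\<Union>(c, d)\<in>?R. {c<..<d} - pointwise_lipschitz_set ?g)"
  proof
    fix t assume t: "t \<in> {t. x + t *\<^sub>R e \<in> ?B}"
    then have "t \<in> ?J" by simp
    then obtain \<rho> where \<rho>: "0 < \<rho>" "ball t \<rho> \<subseteq> ?J" using openE[OF J_open] by blast
    obtain c where c: "c \<in> \<rat>" "t - \<rho> < c" "c < t" using Rats_dense_in_real[of "t - \<rho>" t] \<rho> by auto
    obtain d where d: "d \<in> \<rat>" "t < d" "d < t + \<rho>" using Rats_dense_in_real[of t "t + \<rho>"] \<rho> by auto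
    have "{c..d} \<subseteq> ball t \<rho>" using c d by (auto simp: dist_real_def)
    then have "{c..d} \<subseteq> ?J" using \<rho>(2) by (rule order_trans)
    then have "(c, d) \<in> ?R" using c d by simp
    moreover have "t \<notin> pointwise_lipschitz_set ?g"
      using t pointwise_lipschitz_of_line[where x = x and t = t, OF mono \<eta> e] by auto
    ultimately show "t \<in> (\<Union>(c, d)\<in>?R. {c<..<d} - pointwise_lipschitz_set ?g)"
      using c d by (intro UN_I[of "(c, d)"]) auto
  qed
  moreover have "negligible (\<Union>(c, d)\<in>?R. {c<..<d} - pointwise_lipschitz_set ?g)"
  proof -
    have "countable ?R" by (rule countable_subset[of _ "\<rat> \<times> \<rat>"]) (auto intro: countable_rat)
    then show ?thesis
      using negligible_not_pointwise_lipschitz_mono[OF g_mono]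
      by (intro negligible_countable_Union) auto
  qed
  ultimately have "negligible {t. x + t *\<^sub>R e \<in> ?B}" by (rule negligible_subset[rotated])
  moreover have "?B \<in> sets borel" using pointwise_lipschitz_set_borel by (intro sets.Diff) auto
  ultimately show "{t. x + t *\<^sub>R e \<in> ?B} \<in> null_sets lborel"
    using line_slice_borel negligible_borel_iff_null_sets by blast
qed

text \<open>
  Near each point of \<open>W\<close> the exceptional set is null along every direction from an open set, which
  therefore contains a direction from the dense span of \<open>\<xi>\<close>; countably many of these neighbourhoods
  suffice.
\<close>

theorem cone_monotone_pointwise_lipschitz_off_null:
  fixes f :: "'a::{real_normed_vector, second_countable_topology} \<Rightarrow> real"
  assumes W: "open W" and mono: "\<And>x. x \<in> W \<Longrightarrow> locally_cone_monotone_at f x"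
  shows "strictly_aronszajn_null (W - pointwise_lipschitz_set f)"
proof -
  let ?B = "W - pointwise_lipschitz_set f"
  have B_borel: "?B \<in> sets borel" using W pointwise_lipschitz_set_borel by (intro sets.Diff) auto
  have "\<forall>x\<in>W. \<exists>r v \<eta>. 0 < r \<and> 0 < \<eta> \<and> (\<forall>y\<in>ball x r. \<forall>d\<in>ball v \<eta>. \<forall>t\<ge>0. f y \<le> f (y + t *\<^sub>R d))"
    using mono unfolding locally_cone_monotone_at_def by meson
  then obtain r v \<eta> where rv: "\<And>x. x \<in> W \<Longrightarrow> 0 < r x" "\<And>x. x \<in> W \<Longrightarrow> 0 < \<eta> x"
    "\<And>x y d t. \<lbrakk>x \<in> W; y \<in> ball x (r x); d \<in> ball (v x) (\<eta> x); 0 \<le> t\<rbrakk> \<Longrightarrow> f y \<le> f (y + t *\<^sub>R d)"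
    by metis
  obtain \<F> where \<F>: "\<F> \<subseteq> (\<lambda>x. ball x (r x)) ` W" "countable \<F>" "\<Union>\<F> = (\<Union>x\<in>W. ball x (r x))"
    using Lindelof[of "(\<lambda>x. ball x (r x)) ` W"] by auto
  have "decomposes_along \<xi> ?B" if \<xi>: "closure (span (range \<xi>)) = UNIV" for \<xi> :: "nat \<Rightarrow> 'a"
  proof -
    have "decomposes_along \<xi> (S - pointwise_lipschitz_set f)" if S: "S \<in> \<F>" for S
    proof -
      obtain x where x: "x \<in> W" "S = ball x (r x)" using S \<F>(1) by blast
      have "0 < \<eta> x / 2" using rv(2)[OF x(1)] by simp
      from ex_dense_near[OF \<xi> this] obtain e where e: "e \<in> span (range \<xi>)" "norm (v x - e) < \<eta> x / 2" .
      then have "e \<in> ball (v x) (\<eta> x / 2)" by (simp add: dist_norm)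
      then have "null_along e (ball x (r x) - pointwise_lipschitz_set f)"
        using rv(2,3) x(1) by (intro null_along_not_pointwise_lipschitz[where v = "v x" and \<eta> = "\<eta> x"])
      then show ?thesis
        unfolding x(2) using pointwise_lipschitz_set_borel e(1)
        by (intro decomposes_along_of_null_along_span sets.Diff) auto
    qed
    then have "decomposes_along \<xi> (\<Union>S\<in>\<F>. S - pointwise_lipschitz_set f)"
      using \<F>(2) by (intro decomposes_along_UN)
    moreover have "?B \<subseteq> (\<Union>S\<in>\<F>. S - pointwise_lipschitz_set f)"
    proof
      fix x assume x: "x \<in> ?B"
      then have "x \<in> \<Union>\<F>" unfolding \<F>(3) using rv(1)[of x] by (intro UN_I[of x]) auto
      then show "x \<in> (\<Union>S\<in>\<F>. S - pointwise_lipschitz_set f)" using x by blast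
    qed
    ultimately show ?thesis using B_borel by (rule decomposes_along_subset)
  qed
  then show ?thesis using B_borel by (simp add: strictly_aronszajn_null_def)
qed

text \<open>
  Going back from a point near \<open>x\<close> by a vector close to \<open>x - z\<close> ends near \<open>z\<close>.  Together with the
  next identity, which puts \<open>y\<close> on the segment from \<open>y - d\<close> to \<open>y + t d\<close>, this turns
  quasiconvexity into monotonicity along a cone.
\<close>

lemma backward_point_in_ball:
  fixes z :: "'a::real_normed_vector"
  assumes "y \<in> ball x (r / 2)" "d \<in> ball (x - z) (r / 2)"
  shows "y - d \<in> ball z r"
proof -
  have "z - (y - d) = (x - y) - ((x - z) - d)" by simp
  then have "norm (z - (y - d)) \<le> norm (x - y) + norm ((x - z) - d)"
    by (metis norm_triangle_ineq4)
  also have "\<dots> < r / 2 + r / 2" using assms by (intro add_strict_mono) (auto simp: dist_norm)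
  finally show ?thesis by (simp add: dist_norm)
qed

lemma forward_backward_combination:
  fixes y d :: "'a::real_vector"
  assumes "0 \<le> t"
  shows "y = (1 / (1 + t)) *\<^sub>R (y + t *\<^sub>R d) + (1 - 1 / (1 + t)) *\<^sub>R (y - d)"
proof -
  have a: "1 - 1 / (1 + t) = t / (1 + t)" using assms by (simp add: field_simps)
  have b: "(1 / (1 + t)) *\<^sub>R (y + t *\<^sub>R d) + (t / (1 + t)) *\<^sub>R (y - d) =
      (1 / (1 + t) + t / (1 + t)) *\<^sub>R y"
    by (simp only: scaleR_add_right scaleR_diff_right scaleR_add_left scaleR_scaleR) simp
  have c: "1 / (1 + t) + t / (1 + t) = 1" using assms by (simp add: add_divide_distrib[symmetric])
  show ?thesis unfolding a b c by simp
qed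

text \<open>
  The indicator function of the complement of \<open>C\<close> is monotone along a cone near every point, and it
  is discontinuous at the points of the frontier.
\<close>

theorem frontier_convex_strictly_aronszajn_null:
  fixes C :: "'a::{real_normed_vector, second_countable_topology} set"
  assumes C: "convex C" and r: "0 < r" "ball z r \<subseteq> C"
  shows "strictly_aronszajn_null (frontier C)"
proof -
  define g :: "'a \<Rightarrow> real" where "g x = (if x \<in> C then 0 else 1)" for x
  have "locally_cone_monotone_at g x" for x
    unfolding locally_cone_monotone_at_def
  proof (intro exI conjI ballI allI impI)
    fix y d t assume y: "y \<in> ball x (r / 2)" and d: "d \<in> ball (x - z) (r / 2)" and t: "0 \<le> (t::real)"
    have backward: "y - d \<in> C" using backward_point_in_ball[OF y d] r(2) by blast
    have "y \<in> C" if "y + t *\<^sub>R d \<in> C"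
    proof -
      have "(1 / (1 + t)) *\<^sub>R (y + t *\<^sub>R d) + (1 - 1 / (1 + t)) *\<^sub>R (y - d) \<in> C"
        using t by (intro convexD[OF C that backward]) auto
      then show ?thesis by (simp only: forward_backward_combination[OF t, symmetric])
    qed
    then show "g y \<le> g (y + t *\<^sub>R d)" by (auto simp: g_def)
  qed (use r in auto)
  then have null: "strictly_aronszajn_null (UNIV - pointwise_lipschitz_set g)"
    by (intro cone_monotone_pointwise_lipschitz_off_null) auto
  have "x \<notin> pointwise_lipschitz_set g" if x: "x \<in> frontier C" for x
  proof
    assume "x \<in> pointwise_lipschitz_set g"
    then obtain n where n: "\<And>y. dist y x < 1 / real (Suc n) \<Longrightarrow> \<bar>g y - g x\<bar> \<le> real (Suc n) * dist y x"
      by (auto simp: pointwise_lipschitz_set_def lip_points_def)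
    have const: "g y = g x" if "y \<in> ball x (1 / real (Suc n))" for y
    proof -
      have "dist y x < 1 / real (Suc n)" using that by (simp add: dist_commute)
      then have "\<bar>g y - g x\<bar> \<le> real (Suc n) * dist y x" "real (Suc n) * dist y x < 1"
        using n by (auto simp: field_simps)
      then show ?thesis by (auto simp: g_def split: if_splits)
    qed
    have "\<exists>y\<in>C. dist x y < 1 / real (Suc n)" "\<exists>y. y \<notin> C \<and> dist x y < 1 / real (Suc n)"
      using x by (auto simp: frontier_straddle)
    then obtain y y' where "y \<in> C" "y' \<notin> C" "y \<in> ball x (1 / real (Suc n))" "y' \<in> ball x (1 / real (Suc n))"
      by (auto simp: mem_ball)
    then show False using const[of y] const[of y'] by (auto simp: g_def)
  qed
  then show ?thesis by (intro strictly_aronszajn_null_subset[OF null]) auto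
qed

text \<open>
  Extend the segment from \<open>z\<close> to a point \<open>p\<close> of \<open>U\<close> slightly beyond \<open>p\<close>.  The new end point is
  a limit of points \<open>q'\<close> of \<open>C\<close>, and moving it to \<open>q'\<close> moves the other end only within the ball around \<open>z\<close>.
\<close>

lemma open_subset_closure_convex:
  fixes C :: "'a::real_normed_vector set"
  assumes C: "convex C" and r: "0 < r" "ball z r \<subseteq> C" and U: "open U" "U \<subseteq> closure C"
  shows "U \<subseteq> C"
proof
  fix p assume "p \<in> U"
  then obtain \<rho> where \<rho>: "0 < \<rho>" "ball p \<rho> \<subseteq> U" using openE[OF U(1)] by blast
  define s where "s = \<rho> / (2 * (norm (p - z) + 1))"
  have s: "0 < s" using \<rho> by (simp add: s_def add_nonneg_pos)
  let ?q = "p + s *\<^sub>R (p - z)"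
  have le: "s * norm (p - z) \<le> s * (norm (p - z) + 1)" using s by simp
  have "\<rho> / (2 * M) * M = \<rho> / 2" if "0 < M" for M using that by simp
  from this[of "norm (p - z) + 1"] have "s * (norm (p - z) + 1) = \<rho> / 2"
    by (simp add: s_def add_nonneg_pos)
  with le have "s * norm (p - z) < \<rho>" using \<rho> by simp
  then have "?q \<in> ball p \<rho>" using s by (simp add: dist_norm)
  then have "?q \<in> closure C" using \<rho> U by blast
  then obtain q' where q': "q' \<in> C" "dist q' ?q < s * r"
    using s r by (meson closure_approachable mult_pos_pos)
  \<comment> \<open>The point \<open>p\<close> divides the segment from \<open>q'\<close> to a point of the ball around \<open>z\<close>.\<close>
  let ?z' = "p - (1 / s) *\<^sub>R (q' - p)"
  have "z - ?z' = (1 / s) *\<^sub>R (q' - ?q)" using s by (simp add: algebra_simps)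
  then have "dist z ?z' = dist q' ?q / s" unfolding dist_norm using s by (simp only: norm_scaleR) simp
  also have "\<dots> < r" using q'(2) s by (simp only: pos_divide_less_eq mult.commute)
  finally have "?z' \<in> ball z r" by (simp only: mem_ball)
  then have z': "?z' \<in> C" using r by blast
  have "p = (1 / (1 + s)) *\<^sub>R (p + s *\<^sub>R ((1 / s) *\<^sub>R (q' - p))) + (1 - 1 / (1 + s)) *\<^sub>R ?z'"
    by (rule forward_backward_combination) (use s in simp)
  also have "p + s *\<^sub>R ((1 / s) *\<^sub>R (q' - p)) = q'" using s by simp
  also have "(1 / (1 + s)) *\<^sub>R q' + (1 - 1 / (1 + s)) *\<^sub>R ?z' \<in> C"
    using s by (intro convexD[OF C q'(1) z']) auto
  finally show "p \<in> C" .
qed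

section \<open>Sublevel sets of quasiconvex functions\<close>

lemma quasiconvexD:
  assumes "quasiconvex f" "0 \<le> l" "l \<le> 1"
  shows "f (l *\<^sub>R x + (1 - l) *\<^sub>R y) \<le> max (f x) (f y)"
  using assms by (simp add: quasiconvex_def)

lemma convex_sublevel_quasiconvex:
  assumes "quasiconvex f"
  shows "convex (strict_sublevel f \<alpha>)" "convex (sublevel f \<alpha>)"
proof -
  have *: "ereal (f (u *\<^sub>R x + v *\<^sub>R y)) \<le> max (ereal (f x)) (ereal (f y))"
    if "0 \<le> u" "0 \<le> v" "u + v = 1" for x y and u v :: real
  proof -
    have u: "u \<le> 1" and v: "v = 1 - u" using that by auto
    have "f (u *\<^sub>R x + v *\<^sub>R y) \<le> max (f x) (f y)"
      unfolding v by (rule quasiconvexD[OF assms that(1) u])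
    then show ?thesis by (simp add: max_def split: if_splits)
  qed
  show "convex (strict_sublevel f \<alpha>)"
    unfolding convex_def strict_sublevel_def
  proof (intro ballI allI impI)
    fix x y and u v :: real
    assume "x \<in> {x. ereal (f x) < \<alpha>}" "y \<in> {x. ereal (f x) < \<alpha>}" "0 \<le> u" "0 \<le> v" "u + v = 1"
    then show "u *\<^sub>R x + v *\<^sub>R y \<in> {x. ereal (f x) < \<alpha>}"
      using *[of u v x y] by (auto intro: le_less_trans)
  qed
  show "convex (sublevel f \<alpha>)"
    unfolding convex_def sublevel_def
  proof (intro ballI allI impI)
    fix x y and u v :: real
    assume "x \<in> {x. ereal (f x) \<le> \<alpha>}" "y \<in> {x. ereal (f x) \<le> \<alpha>}" "0 \<le> u" "0 \<le> v" "u + v = 1"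
    then show "u *\<^sub>R x + v *\<^sub>R y \<in> {x. ereal (f x) \<le> \<alpha>}"
      using *[of u v x y] by (auto intro: order_trans)
  qed
qed

text \<open>
  If \<open>y\<close> lies on the segment from \<open>y - d\<close> to \<open>y + t d\<close>, where \<open>f (y - d) < \<beta> \<le> f y\<close>, then the maximum
  in the quasiconvexity inequality can only be attained at \<open>y + t d\<close>.
\<close>

lemma quasiconvex_locally_cone_monotone:
  fixes f :: "'a::real_normed_vector \<Rightarrow> real"
  assumes qc: "quasiconvex f" and r: "0 < r" "ball z r \<subseteq> {x. f x < \<beta>}"
    and x: "x \<notin> closure {x. f x < \<beta>}"
  shows "locally_cone_monotone_at f x"
proof -
  obtain \<rho> where \<rho>: "0 < \<rho>" "ball x \<rho> \<subseteq> - closure {x. f x < \<beta>}"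
    using openE[of "- closure {x. f x < \<beta>}" x] x by auto
  show ?thesis
    unfolding locally_cone_monotone_at_def
  proof (intro exI conjI ballI allI impI)
    fix y d t assume y: "y \<in> ball x (min \<rho> (r / 2))" and d: "d \<in> ball (x - z) (r / 2)" and t: "0 \<le> (t::real)"
    have "y \<in> ball x (r / 2)" using y by simp
    from backward_point_in_ball[OF this d] have "f (y - d) < \<beta>" using r(2) by blast
    moreover have "\<beta> \<le> f y"
    proof (rule ccontr)
      assume "\<not> \<beta> \<le> f y"
      then have "y \<in> closure {x. f x < \<beta>}" using closure_subset by fastforce
      then show False using y \<rho>(2) by auto
    qed
    moreover have "f y \<le> max (f (y + t *\<^sub>R d)) (f (y - d))"
      using quasiconvexD[OF qc, of "1 / (1 + t)" "y + t *\<^sub>R d" "y - d"] t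
      unfolding forward_backward_combination[OF t, symmetric] by simp
    ultimately show "f y \<le> f (y + t *\<^sub>R d)" by linarith
  qed (use \<rho> r in auto)
qed

text \<open>
  If the sublevel set at height \<open>\<alpha>\<close> is dense in an open set, then \<open>f \<le> \<alpha>\<close> at each continuity point in
  that open set, so \<open>f < \<beta>\<close> near it.
\<close>

lemma strict_sublevel_contains_ball:
  fixes f :: "'a::metric_space \<Rightarrow> real"
  assumes dc: "densely_continuous f" and nd: "\<not> nowhere_dense {x. f x < \<alpha>}" and "\<alpha> < \<beta>"
  obtains z r where "0 < r" "ball z r \<subseteq> {x. f x < \<beta>}"
proof -
  let ?U = "interior (closure {x. f x < \<alpha>})"
  obtain D where D: "closure D = UNIV" "\<And>x. x \<in> D \<Longrightarrow> isCont f x"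
    using dc by (auto simp: densely_continuous_def)
  have "?U \<inter> closure D \<noteq> {}" using nd D by (simp add: nowhere_dense_def)
  then have "?U \<inter> D \<noteq> {}" by (simp add: open_Int_closure_eq_empty)
  then obtain z where z: "z \<in> ?U" "z \<in> D" by blast
  then have cont: "(f \<longlongrightarrow> f z) (nhds z)" using D by (simp add: continuous_at tendsto_at_iff_tendsto_nhds)
  have "f z \<le> \<alpha>"
  proof (rule ccontr)
    assume "\<not> f z \<le> \<alpha>"
    then have "eventually (\<lambda>y. \<alpha> < f y) (nhds z)" using cont by (intro order_tendstoD) auto
    then obtain V where V: "open V" "z \<in> V" "\<And>y. y \<in> V \<Longrightarrow> \<alpha> < f y" by (auto simp: eventually_nhds)
    have "z \<in> closure {x. f x < \<alpha>}" using z interior_subset by blast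
    then have "V \<inter> closure {x. f x < \<alpha>} \<noteq> {}" using V by blast
    then have "V \<inter> {x. f x < \<alpha>} \<noteq> {}" using V(1) by (simp add: open_Int_closure_eq_empty)
    then show False using V(3) by force
  qed
  then have "eventually (\<lambda>y. f y < \<beta>) (nhds z)" using \<open>\<alpha> < \<beta>\<close> by (intro order_tendstoD(2)[OF cont]) simp
  then obtain r where "0 < r" "\<And>y. dist y z < r \<Longrightarrow> f y < \<beta>" by (auto simp: eventually_nhds_metric)
  then show thesis by (intro that[of r z]) (auto simp: dist_commute)
qed

section \<open>Haar null sets\<close>

lemma translate_eq_vimage: "(\<lambda>y. x + y) ` E = {z. z - x \<in> E}" for x :: "'a::ab_group_add"
  by (auto simp: image_iff intro!: bexI[of _ "_ - x"])

lemma translate_borel: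
  fixes E :: "'a::real_normed_vector set"
  assumes "E \<in> sets borel"
  shows "(\<lambda>y. x + y) ` E \<in> sets borel"
proof -
  have "(\<lambda>z. z - x) \<in> borel_measurable borel"
    by (intro borel_measurable_continuous_onI continuous_intros)
  from measurable_sets[OF this assms] show ?thesis by (simp add: translate_eq_vimage vimage_def)
qed

text \<open>
  The convolution of a measure that is null on the translates of \<open>E\<close> with one that is null on the
  translates of \<open>F\<close> is null on both.
\<close>

lemma haar_null_Un:
  fixes E F :: "'a::{real_normed_vector, second_countable_topology} set"
  assumes "haar_null E" "haar_null F"
  shows "haar_null (E \<union> F)"
proof -
  obtain \<mu> :: "'a measure" where \<mu>: "sets \<mu> = sets borel" "prob_space \<mu>"
    "\<And>x. emeasure \<mu> ((\<lambda>y. x + y) ` E) = 0" using assms(1) by (auto simp: haar_null_def)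
  obtain \<nu> :: "'a measure" where \<nu>: "sets \<nu> = sets borel" "prob_space \<nu>"
    "\<And>x. emeasure \<nu> ((\<lambda>y. x + y) ` F) = 0" using assms(2) by (auto simp: haar_null_def)
  have borel: "E \<in> sets borel" "F \<in> sets borel" using assms by (auto simp: haar_null_def)
  interpret M: prob_space \<mu> by (rule \<mu>(2))
  interpret N: prob_space \<nu> by (rule \<nu>(2))
  interpret P: pair_prob_space \<mu> \<nu> ..
  have sets_pair: "sets (\<mu> \<Otimes>\<^sub>M \<nu>) = sets (borel :: ('a \<times> 'a) measure)"
    unfolding borel_prod[symmetric] by (rule sets_pair_measure_cong[OF \<mu>(1) \<nu>(1)])
  then have space_pair: "space (\<mu> \<Otimes>\<^sub>M \<nu>) = UNIV" using sets_eq_imp_space_eq by fastforce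
  let ?add = "\<lambda>p :: 'a \<times> 'a. fst p + snd p"
  have add: "?add \<in> measurable (\<mu> \<Otimes>\<^sub>M \<nu>) borel"
    unfolding measurable_cong_sets[OF sets_pair refl]
    by (intro borel_measurable_continuous_onI continuous_intros)
  let ?\<rho> = "distr (\<mu> \<Otimes>\<^sub>M \<nu>) borel ?add"
  have em: "emeasure ?\<rho> S = emeasure (\<mu> \<Otimes>\<^sub>M \<nu>) (?add -` S)"
    and meas: "?add -` S \<in> sets (\<mu> \<Otimes>\<^sub>M \<nu>)" if "S \<in> sets borel" for S
    using emeasure_distr[OF add that] measurable_sets[OF add that] by (simp_all add: space_pair)
  have "emeasure ?\<rho> ((\<lambda>y. x + y) ` E) = 0" for x
  proof -
    note S = translate_borel[OF borel(1), of x]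
    have "emeasure ?\<rho> ((\<lambda>y. x + y) ` E) =
        (\<integral>\<^sup>+b. emeasure \<mu> ((\<lambda>a. (a, b)) -` (?add -` ((\<lambda>y. x + y) ` E))) \<partial>\<nu>)"
      unfolding em[OF S] by (rule P.emeasure_pair_measure_alt2[OF meas[OF S]])
    also have "(\<lambda>b. (\<lambda>a. (a, b)) -` (?add -` ((\<lambda>y. x + y) ` E))) = (\<lambda>b. (\<lambda>y. (x - b) + y) ` E)"
      by (auto simp: translate_eq_vimage algebra_simps)
    finally show ?thesis using \<mu>(3) by (simp add: fun_eq_iff)
  qed
  moreover have "emeasure ?\<rho> ((\<lambda>y. x + y) ` F) = 0" for x
  proof -
    note S = translate_borel[OF borel(2), of x]
    have "emeasure ?\<rho> ((\<lambda>y. x + y) ` F) =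
        (\<integral>\<^sup>+a. emeasure \<nu> (Pair a -` (?add -` ((\<lambda>y. x + y) ` F))) \<partial>\<mu>)"
      unfolding em[OF S] by (rule N.emeasure_pair_measure_alt[OF meas[OF S]])
    also have "(\<lambda>a. Pair a -` (?add -` ((\<lambda>y. x + y) ` F))) = (\<lambda>a. (\<lambda>y. (x - a) + y) ` F)"
      by (auto simp: translate_eq_vimage algebra_simps)
    finally show ?thesis using \<nu>(3) by simp
  qed
  ultimately have "emeasure ?\<rho> ((\<lambda>y. x + y) ` (E \<union> F)) = 0" for x
    unfolding image_Un using translate_borel[OF borel(1), of x] translate_borel[OF borel(2), of x]
    by (intro emeasure_Un_null_set[THEN trans]) (auto simp: null_sets_def)
  moreover have "prob_space ?\<rho>" by (rule P.prob_space_distr[OF add])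
  ultimately show ?thesis
    unfolding haar_null_def using borel by (intro conjI exI[of _ ?\<rho>]) auto
qed

text \<open>
  The measure is the law of the random series \<open>\<Sum>n. \<omega> n \<xi> n\<close> with independent coefficients, uniform on
  \<open>[0, 1]\<close>, where the \<open>\<xi> n\<close> are shrunk multiples of a dense sequence.  Resampling the coefficient
  with index \<open>n\<close> moves the sum along a line in direction \<open>\<xi> n\<close>, which meets \<open>A n\<close> in a null set.
\<close>

theorem strictly_aronszajn_null_imp_haar_null:
  fixes E :: "'a::{banach, second_countable_topology} set"
  assumes E: "strictly_aronszajn_null E"
  shows "haar_null E"
proof -
  obtain H :: "'a set" where H: "countable H" "closure UNIV \<subseteq> closure H"
    using countable_dense_subset[of UNIV] by metis
  then have cl: "closure H = UNIV" by auto
  then have "H \<noteq> {}" by auto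
  define d where "d = from_nat_into H"
  have range_d: "range d = H" unfolding d_def using \<open>H \<noteq> {}\<close> H(1) by (rule range_from_nat_into)
  \<comment> \<open>The factor \<open>c n\<close> makes the series absolutely convergent for all coefficients in \<open>[0, 1]\<close>.\<close>
  define c where "c n = (1 / 2) ^ n / (1 + norm (d n))" for n
  define \<xi> where "\<xi> n = c n *\<^sub>R d n" for n
  have c_pos: "0 < c n" for n by (simp add: c_def add_pos_nonneg)
  have \<xi>_bound: "norm (\<xi> n) \<le> (1 / 2) ^ n" for n
  proof -
    have "norm (\<xi> n) = (1 / 2) ^ n * (norm (d n) / (1 + norm (d n)))"
      using c_pos[of n] by (simp add: \<xi>_def c_def add_nonneg_eq_0_iff)
    also have "\<dots> \<le> (1 / 2) ^ n * 1"
      by (intro mult_left_mono) (auto simp: divide_le_eq_1 add_pos_nonneg)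
    finally show ?thesis by simp
  qed
  have "H \<subseteq> span (range \<xi>)"
  proof
    fix h assume "h \<in> H"
    then obtain n where "h = d n" using range_d by auto
    then have "h = (1 / c n) *\<^sub>R \<xi> n" using c_pos[of n] by (simp add: \<xi>_def)
    then show "h \<in> span (range \<xi>)" by (simp add: span_scale span_base)
  qed
  then have "closure (span (range \<xi>)) = UNIV" using closure_mono cl by blast
  then obtain A where A: "E = (\<Union>n. A n)" "\<And>n. A n \<in> sets borel" "\<And>n. null_along (\<xi> n) (A n)"
    using E unfolding strictly_aronszajn_null_def decomposes_along_def by metis
  define M where "M = restrict_space lborel {0..1::real}"
  define P where "P = (\<Pi>\<^sub>M n\<in>(UNIV :: nat set). M)"
  have space_M: "space M = {0..1}" by (simp add: M_def space_restrict_space)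
  have M_prob: "prob_space M"
  proof (rule prob_spaceI)
    show "emeasure M (space M) = 1"
      unfolding space_M by (simp add: M_def emeasure_restrict_space)
  qed
  interpret M: prob_space M by (rule M_prob)
  have P_prob: "prob_space P" unfolding P_def by (rule prob_space_PiM) (rule M_prob)
  interpret P: prob_space P by (rule P_prob)
  interpret MP: pair_prob_space M P ..
  have space_P: "\<omega> \<in> space P \<longleftrightarrow> (\<forall>n. \<omega> n \<in> {0..1})" for \<omega>
    by (auto simp: P_def space_PiM space_M PiE_def extensional_def)
  define Z where "Z \<omega> = (\<Sum>n. \<omega> n *\<^sub>R \<xi> n)" for \<omega> :: "nat \<Rightarrow> real"
  have M_id: "(\<lambda>t. t) \<in> borel_measurable M"
    unfolding M_def by (rule measurable_restrict_space1) simp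
  have Z_meas: "Z \<in> borel_measurable P"
    unfolding Z_def[abs_def]
  proof (intro borel_measurable_suminf borel_measurable_scaleR borel_measurable_const)
    fix n
    have "(\<lambda>\<omega>. \<omega> n) \<in> measurable P M" unfolding P_def by (rule measurable_component_singleton) simp
    then show "(\<lambda>\<omega>. \<omega> n) \<in> borel_measurable P" using M_id by (rule measurable_compose)
  qed
  have summ: "summable (\<lambda>n. \<omega> n *\<^sub>R \<xi> n)" if "\<And>n. \<omega> n \<in> {0..1}" for \<omega>
  proof (rule summable_comparison_test)
    have "norm (\<omega> n *\<^sub>R \<xi> n) \<le> 1 * (1 / 2) ^ n" for n
      using that[of n] \<xi>_bound[of n] unfolding norm_scaleR by (intro mult_mono) auto
    then show "\<exists>N. \<forall>n\<ge>N. norm (\<omega> n *\<^sub>R \<xi> n) \<le> (1 / 2) ^ n" by auto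
  qed (rule summable_geometric, simp)
  have Z_upd: "Z (fun_upd \<omega> n s) = Z (fun_upd \<omega> n 0) + s *\<^sub>R \<xi> n" if "\<omega> \<in> space P" for \<omega> n s
  proof -
    have s0: "summable (\<lambda>k. (fun_upd \<omega> n 0) k *\<^sub>R \<xi> k)" using that by (intro summ) (auto simp: space_P)
    have s1: "(\<lambda>k. if k = n then s *\<^sub>R \<xi> k else 0) sums (s *\<^sub>R \<xi> n)" by (rule sums_single)
    have "(\<lambda>k. (fun_upd \<omega> n s) k *\<^sub>R \<xi> k) = (\<lambda>k. (fun_upd \<omega> n 0) k *\<^sub>R \<xi> k + (if k = n then s *\<^sub>R \<xi> k else 0))"
      by auto
    then have "(\<lambda>k. (fun_upd \<omega> n s) k *\<^sub>R \<xi> k) sums (Z (fun_upd \<omega> n 0) + s *\<^sub>R \<xi> n)"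
      unfolding Z_def using sums_add[OF summable_sums[OF s0] s1] by simp
    then show ?thesis unfolding Z_def by (rule sums_unique[symmetric])
  qed
  have null: "emeasure P (Z -` ((\<lambda>y. x + y) ` A n) \<inter> space P) = 0" for x n
  proof -
    let ?S = "Z -` ((\<lambda>y. x + y) ` A n) \<inter> space P"
    let ?u = "\<lambda>(s, \<omega>). fun_upd (\<omega> :: nat \<Rightarrow> real) n s"
    have S: "?S \<in> sets P" by (rule measurable_sets[OF Z_meas translate_borel[OF A(2)]])
    have P_eq: "distr (M \<Otimes>\<^sub>M P) P ?u = P"
      using distr_pair_PiM_eq_PiM[of UNIV "\<lambda>_. M" n] M_prob unfolding P_def by simp
    have u: "?u \<in> measurable (M \<Otimes>\<^sub>M P) P"
      unfolding P_def case_prod_beta' by (rule measurable_fun_upd[where J = UNIV]) auto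
    have pre: "?u -` ?S \<inter> space (M \<Otimes>\<^sub>M P) \<in> sets (M \<Otimes>\<^sub>M P)" by (rule measurable_sets[OF u S])
    have "emeasure P ?S = emeasure (M \<Otimes>\<^sub>M P) (?u -` ?S \<inter> space (M \<Otimes>\<^sub>M P))"
      using emeasure_distr[OF u S] unfolding P_eq .
    also have "\<dots> = (\<integral>\<^sup>+\<omega>. emeasure M ((\<lambda>s. (s, \<omega>)) -` (?u -` ?S \<inter> space (M \<Otimes>\<^sub>M P))) \<partial>P)"
      by (rule MP.emeasure_pair_measure_alt2[OF pre])
    also have "\<dots> = (\<integral>\<^sup>+\<omega>. 0 \<partial>P)"
    proof (rule nn_integral_cong)
      fix \<omega> assume \<omega>: "\<omega> \<in> space P"
      let ?T = "(\<lambda>s. (s, \<omega>)) -` (?u -` ?S \<inter> space (M \<Otimes>\<^sub>M P))"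
      let ?L = "{s. (Z (fun_upd \<omega> n 0) - x) + s *\<^sub>R \<xi> n \<in> A n}"
      have "?T \<subseteq> {0..1}" using space_M by (auto simp: space_pair_measure)
      have "?T \<subseteq> ?L"
      proof
        fix s assume "s \<in> ?T"
        then have "Z (fun_upd \<omega> n s) - x \<in> A n" by (simp add: translate_eq_vimage)
        then show "s \<in> ?L" unfolding Z_upd[OF \<omega>, of n s] by (simp add: algebra_simps)
      qed
      have L: "?L \<in> null_sets lborel" using A(3) by (simp add: null_along_def)
      have "emeasure M ?T = emeasure lborel ?T"
        using emeasure_restrict_space[OF _ \<open>?T \<subseteq> {0..1}\<close>, of lborel] by (simp only: M_def) simp
      also have "\<dots> \<le> emeasure lborel ?L"
        using L \<open>?T \<subseteq> ?L\<close> by (intro emeasure_mono) auto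
      also have "\<dots> = 0" using L by auto
      finally show "emeasure M ?T = 0" by simp
    qed
    finally show ?thesis by simp
  qed
  have "emeasure (distr P borel Z) ((\<lambda>y. x + y) ` E) = 0" for x
  proof -
    have borel: "(\<lambda>y. x + y) ` A n \<in> sets borel" for n by (rule translate_borel[OF A(2)])
    have "(\<lambda>y. x + y) ` A n \<in> null_sets (distr P borel Z)" for n
      using null[of x n] borel by (simp add: null_sets_def emeasure_distr[OF Z_meas borel])
    then have "(\<Union>n. (\<lambda>y. x + y) ` A n) \<in> null_sets (distr P borel Z)" by (rule null_sets_UN)
    then show ?thesis unfolding A(1) image_UN by auto
  qed
  moreover have "prob_space (distr P borel Z)" by (rule P.prob_space_distr[OF Z_meas])
  moreover have "E \<in> sets borel" using E by (simp add: strictly_aronszajn_null_def)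
  ultimately show ?thesis
    unfolding haar_null_def by (intro conjI exI[of _ "distr P borel Z"]) auto
qed

section \<open>Differentiability of quasiconvex functions\<close>

lemma has_hadamard_derivative_const: "has_hadamard_derivative (\<lambda>_. c) (\<lambda>_. 0) x"
  unfolding has_hadamard_derivative_def diff_quotient_def by (auto intro: uniform_limit_const)

lemma hadamard_differentiable_locally_constant:
  fixes f :: "'a::real_normed_vector \<Rightarrow> real"
  assumes "open V" "x \<in> V" "\<And>y. y \<in> V \<Longrightarrow> f y = f x"
  shows "hadamard_differentiable_at f x"
proof -
  obtain r where r: "0 < r" "ball x r \<subseteq> V" using openE[OF assms(1,2)] by blast
  have "f x \<le> f y \<and> f y \<le> f x" if "y \<in> ball x r" for y
  proof -
    have "y \<in> V" using that r(2) by blast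
    then show ?thesis using assms(3) by simp
  qed
  then show ?thesis
    by (rule hadamard_differentiable_sandwich[OF r(1) _ refl refl
          has_hadamard_derivative_const has_hadamard_derivative_const])
qed

lemma nowhere_dense_imp_first_category: "nowhere_dense S \<Longrightarrow> first_category S"
  unfolding first_category_def by (intro exI[of _ "\<lambda>_. S"]) auto

lemma strict_sublevel_real: "strict_sublevel f (ereal \<beta>) = {x. f x < \<beta>}"
  by (simp add: strict_sublevel_def)

lemma strict_sublevel_above_ess_inf_contains_ball:
  fixes f :: "'a::metric_space \<Rightarrow> real"
  assumes dc: "densely_continuous f" and \<beta>: "top_ess_inf f < ereal \<beta>"
  obtains z r where "0 < r" "ball z r \<subseteq> {x. f x < \<beta>}"
proof -
  obtain \<alpha> where \<alpha>: "top_ess_inf f < ereal \<alpha>" "ereal \<alpha> < ereal \<beta>" using ereal_dense2[OF \<beta>] by blast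
  have "\<not> first_category (strict_sublevel f (ereal \<alpha>))"
  proof
    assume "first_category (strict_sublevel f (ereal \<alpha>))"
    then have "ereal \<alpha> \<le> top_ess_inf f" unfolding top_ess_inf_def by (intro SUP_upper) simp
    then show False using \<alpha>(1) by simp
  qed
  then have "\<not> nowhere_dense {x. f x < \<alpha>}"
    using nowhere_dense_imp_first_category by (metis strict_sublevel_real)
  then show thesis
    using strict_sublevel_contains_ball[OF dc, of \<alpha> \<beta>] \<alpha>(2) that by auto
qed

lemma ereal_rational_between:
  assumes "x < (y :: ereal)"
  obtains q where "q \<in> \<rat>" "x < ereal q" "ereal q < y"
  using ereal_dense3[OF assms] by (metis Rats_of_rat)

text \<open>
  If \<open>f x\<close> exceeds a rational level \<open>\<beta>\<close> above the essential infimum, then \<open>x\<close> lies either off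
  the closure of the sublevel set at height \<open>\<beta>\<close>, where \<open>f\<close> is monotone along a cone, or on the
  frontier of this convex set, which has interior points.
\<close>

theorem quasiconvex_hadamard_above_ess_inf:
  fixes f :: "'a::{real_normed_vector, second_countable_topology} \<Rightarrow> real"
  assumes qc: "quasiconvex f" and dc: "densely_continuous f"
  shows "\<exists>N. strictly_aronszajn_null N \<and>
    (\<forall>x. x \<notin> N \<and> x \<notin> sublevel f (top_ess_inf f) \<longrightarrow> hadamard_differentiable_at f x)"
proof -
  let ?F = "\<lambda>\<beta>. {x. f x < \<beta>}"
  let ?R = "{\<beta> \<in> \<rat>. top_ess_inf f < ereal \<beta>}"
  have R: "countable ?R" using countable_rat by (rule countable_subset[rotated]) auto
  have ball: "\<exists>z r. 0 < r \<and> ball z r \<subseteq> ?F \<beta>" if "\<beta> \<in> ?R" for \<beta>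
    using strict_sublevel_above_ess_inf_contains_ball[OF dc, of \<beta>] that by (metis (mono_tags, lifting) mem_Collect_eq)
  obtain N where N: "strictly_aronszajn_null N"
    "\<And>x. x \<in> pointwise_lipschitz_set f - N \<Longrightarrow> hadamard_differentiable_at f x"
    using stepanov_hadamard[of f] by blast
  define W where "W = (\<Union>\<beta>\<in>?R. - closure (?F \<beta>))"
  have "open W" unfolding W_def by (intro open_UN ballI open_Compl closed_closure)
  moreover have "locally_cone_monotone_at f x" if x: "x \<in> W" for x
  proof -
    obtain \<beta> where \<beta>: "\<beta> \<in> ?R" "x \<notin> closure (?F \<beta>)" using x by (auto simp: W_def)
    obtain z r where "0 < r" "ball z r \<subseteq> ?F \<beta>" using ball[OF \<beta>(1)] by blast
    then show ?thesis using \<beta>(2) by (rule quasiconvex_locally_cone_monotone[OF qc])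
  qed
  ultimately have W: "strictly_aronszajn_null (W - pointwise_lipschitz_set f)"
    by (rule cone_monotone_pointwise_lipschitz_off_null)
  have "strictly_aronszajn_null (frontier (?F \<beta>))" if \<beta>: "\<beta> \<in> ?R" for \<beta>
  proof -
    obtain z r where "0 < r" "ball z r \<subseteq> ?F \<beta>" using ball[OF \<beta>] by blast
    moreover have "convex (?F \<beta>)"
      using convex_sublevel_quasiconvex(1)[OF qc, of "ereal \<beta>"] by (simp add: strict_sublevel_real)
    ultimately show ?thesis by (intro frontier_convex_strictly_aronszajn_null)
  qed
  then have fr: "strictly_aronszajn_null (\<Union>\<beta>\<in>?R. frontier (?F \<beta>))"
    using R by (intro strictly_aronszajn_null_UN)
  let ?N = "N \<union> (W - pointwise_lipschitz_set f) \<union> (\<Union>\<beta>\<in>?R. frontier (?F \<beta>))"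
  have "hadamard_differentiable_at f x" if x: "x \<notin> ?N" "x \<notin> sublevel f (top_ess_inf f)" for x
  proof -
    have "top_ess_inf f < ereal (f x)" using x(2) by (simp add: sublevel_def not_le)
    then obtain \<beta> where \<beta>: "\<beta> \<in> \<rat>" "top_ess_inf f < ereal \<beta>" "ereal \<beta> < ereal (f x)"
      by (rule ereal_rational_between)
    then have "x \<notin> interior (?F \<beta>)" using interior_subset[of "?F \<beta>"] by auto
    moreover have "x \<notin> frontier (?F \<beta>)" using x(1) \<beta> by auto
    ultimately have "x \<notin> closure (?F \<beta>)" by (simp add: frontier_def)
    then have "x \<in> W" using \<beta> by (auto simp: W_def)
    then have "x \<in> pointwise_lipschitz_set f - N" using x(1) by blast
    then show ?thesis by (rule N(2))
  qed
  moreover have "strictly_aronszajn_null ?N"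
    by (intro strictly_aronszajn_null_Un N(1) W fr)
  ultimately show ?thesis by blast
qed

text \<open>
  An open set in which the minimal level set \<open>F'\<close> is dense is contained in each of the convex
  sublevel sets above it, hence in \<open>F'\<close>.  So \<open>F'\<close> has interior points and its frontier is null,
  and \<open>f\<close> is locally constant on the interior of \<open>F'\<close> away from the closure of the strict
  sublevel set.
\<close>

theorem quasiconvex_hadamard_minimal_level:
  fixes f :: "'a::{real_normed_vector, second_countable_topology} \<Rightarrow> real"
  assumes qc: "quasiconvex f" and dc: "densely_continuous f"
    and nd: "\<not> nowhere_dense (sublevel f (top_ess_inf f))"
  shows "\<exists>N. strictly_aronszajn_null N \<and>
    (\<forall>x. x \<notin> N \<and> x \<notin> closure (strict_sublevel f (top_ess_inf f)) \<longrightarrow> hadamard_differentiable_at f x)"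
proof -
  let ?m = "top_ess_inf f"
  let ?F' = "sublevel f ?m"
  let ?U = "interior (closure ?F')"
  have "?U \<noteq> {}" using nd by (simp add: nowhere_dense_def)
  have "?U \<subseteq> ?F'"
  proof
    fix x assume x: "x \<in> ?U"
    show "x \<in> ?F'"
    proof (rule ccontr)
      assume "x \<notin> ?F'"
      then have "?m < ereal (f x)" by (simp add: sublevel_def not_le)
      then obtain \<beta> where \<beta>: "?m < ereal \<beta>" "ereal \<beta> < ereal (f x)" using ereal_dense2 by blast
      obtain z r where zr: "0 < r" "ball z r \<subseteq> {x. f x < \<beta>}"
        by (rule strict_sublevel_above_ess_inf_contains_ball[OF dc \<beta>(1)])
      have convex: "convex {x. f x < \<beta>}"
        using convex_sublevel_quasiconvex(1)[OF qc, of "ereal \<beta>"] by (simp add: strict_sublevel_real)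
      have "?F' \<subseteq> {x. f x < \<beta>}"
      proof
        fix y assume "y \<in> ?F'"
        then have "ereal (f y) \<le> ?m" by (simp add: sublevel_def)
        then have "ereal (f y) < ereal \<beta>" using \<beta>(1) by (rule le_less_trans)
        then show "y \<in> {x. f x < \<beta>}" by simp
      qed
      then have "?U \<subseteq> closure {x. f x < \<beta>}"
        by (intro order_trans[OF interior_subset] closure_mono)
      from open_subset_closure_convex[OF convex zr open_interior this]
      have "?U \<subseteq> {x. f x < \<beta>}" .
      then show False using x \<beta>(2) by auto
    qed
  qed
  moreover obtain z where "z \<in> ?U" using \<open>?U \<noteq> {}\<close> by blast
  ultimately obtain r where "0 < r" "ball z r \<subseteq> ?F'"
    using openE[OF open_interior, of z "closure ?F'"] by (metis order_trans)
  then have fr: "strictly_aronszajn_null (frontier ?F')"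
    by (intro frontier_convex_strictly_aronszajn_null convex_sublevel_quasiconvex(2)[OF qc])
  obtain N where N: "strictly_aronszajn_null N"
    "\<And>x. x \<notin> N \<Longrightarrow> x \<notin> ?F' \<Longrightarrow> hadamard_differentiable_at f x"
    using quasiconvex_hadamard_above_ess_inf[OF qc dc] by blast
  have "hadamard_differentiable_at f x"
    if x: "x \<notin> N \<union> frontier ?F'" "x \<notin> closure (strict_sublevel f ?m)" for x
  proof (cases "x \<in> ?F'")
    case True
    let ?V = "interior ?F' \<inter> - closure (strict_sublevel f ?m)"
    have x_V: "x \<in> ?V" using True x closure_subset[of ?F'] by (auto simp: frontier_def)
    have level: "ereal (f y) = ?m" if "y \<in> ?V" for y
    proof (rule antisym)
      show "ereal (f y) \<le> ?m" using that interior_subset[of ?F'] by (auto simp: sublevel_def)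
      have "y \<notin> strict_sublevel f ?m" using that closure_subset[of "strict_sublevel f ?m"] by auto
      then show "?m \<le> ereal (f y)" by (simp add: strict_sublevel_def not_less)
    qed
    have const: "f y = f x" if y: "y \<in> ?V" for y
    proof -
      have "ereal (f y) = ereal (f x)" unfolding level[OF y] level[OF x_V] ..
      then show ?thesis by simp
    qed
    have "open ?V" by (intro open_Int open_interior open_Compl closed_closure)
    then show ?thesis using x_V const by (rule hadamard_differentiable_locally_constant)
  next
    case False
    then show ?thesis using N(2) x(1) by blast
  qed
  moreover have "strictly_aronszajn_null (N \<union> frontier ?F')"
    by (intro strictly_aronszajn_null_Un N(1) fr)
  ultimately show ?thesis by blast
qed

lemma dense_complement_closure_nowhere_dense:
  "nowhere_dense S \<Longrightarrow> closure (- closure S) = UNIV"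
  by (simp add: nowhere_dense_def closure_complement)

theorem theorem5p4:
  fixes f :: "'a::{banach, second_countable_topology} \<Rightarrow> real"
    and m :: ereal
  assumes "quasiconvex f"
    and "densely_continuous f"
    and "m = top_ess_inf f"
    and "nowhere_dense (strict_sublevel f m)"
  shows "(\<exists>U. open U \<and> closure U = UNIV \<and>
            holds_except_null aronszajn_null U (hadamard_differentiable_at f))
    \<and> ((\<exists>N. aronszajn_null N \<and> sublevel f m \<subseteq> N)
         \<or> second_category (sublevel f m) \<and> aronszajn_null (closure (strict_sublevel f m))
       \<longrightarrow> holds_except_null aronszajn_null UNIV (hadamard_differentiable_at f))
    \<and> ((\<exists>N. haar_null N \<and> sublevel f m \<subseteq> N)
         \<or> second_category (sublevel f m) \<and> haar_null (closure (strict_sublevel f m))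
       \<longrightarrow> holds_except_null haar_null UNIV (hadamard_differentiable_at f))"
proof -
  obtain N where N: "strictly_aronszajn_null N"
    "\<And>x. x \<notin> N \<Longrightarrow> x \<notin> sublevel f m \<Longrightarrow> hadamard_differentiable_at f x"
    using quasiconvex_hadamard_above_ess_inf[OF assms(1,2)] assms(3) by blast
  have minimal: "\<exists>N'. strictly_aronszajn_null N' \<and>
      (\<forall>x. x \<notin> N' \<and> x \<notin> closure (strict_sublevel f m) \<longrightarrow> hadamard_differentiable_at f x)"
    if "\<not> nowhere_dense (sublevel f m)"
    using quasiconvex_hadamard_minimal_level[OF assms(1,2)] that assms(3) by blast
  have on: "\<exists>M. null M \<and> (\<forall>x\<in>UNIV - M. hadamard_differentiable_at f x)"
    if disj: "(\<exists>N. null N \<and> sublevel f m \<subseteq> N) \<or>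
        second_category (sublevel f m) \<and> null (closure (strict_sublevel f m))"
      and Un: "\<And>E F. null E \<Longrightarrow> strictly_aronszajn_null F \<Longrightarrow> null (E \<union> F)" for null
    using disj
  proof (elim disjE exE conjE)
    fix M assume M: "null M" "sublevel f m \<subseteq> M"
    then show ?thesis using Un[OF M(1) N(1)] N(2) by (intro exI[of _ "M \<union> N"]) auto
  next
    assume "second_category (sublevel f m)" and cl: "null (closure (strict_sublevel f m))"
    then obtain N' where "strictly_aronszajn_null N'"
      "\<And>x. x \<notin> N' \<Longrightarrow> x \<notin> closure (strict_sublevel f m) \<Longrightarrow> hadamard_differentiable_at f x"
      using minimal nowhere_dense_imp_first_category by blast
    then show ?thesis
      using Un[OF cl] by (intro exI[of _ "closure (strict_sublevel f m) \<union> N'"]) auto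
  qed
  have aron: "aronszajn_null F" if "strictly_aronszajn_null F" for F :: "'a set"
    using aronszajn_null_Un_strictly[OF aronszajn_null_empty that] by simp
  have first: "\<exists>U. open U \<and> closure U = UNIV \<and> holds_except_null aronszajn_null U (hadamard_differentiable_at f)"
  proof (cases "nowhere_dense (sublevel f m)")
    case True
    let ?U = "- closure (sublevel f m)"
    have "\<forall>x\<in>?U - N. hadamard_differentiable_at f x" using N(2) closure_subset by blast
    then show ?thesis
      using dense_complement_closure_nowhere_dense[OF True] aron[OF N(1)]
      unfolding holds_except_null_def by (intro exI[of _ ?U]) auto
  next
    case False
    let ?U = "- closure (strict_sublevel f m)"
    obtain N' where "strictly_aronszajn_null N'" "\<forall>x\<in>?U - N'. hadamard_differentiable_at f x"
      using minimal[OF False] by blast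
    then show ?thesis
      using dense_complement_closure_nowhere_dense[OF assms(4)] aron
      unfolding holds_except_null_def by (intro exI[of _ ?U]) auto
  qed
  have haar: "haar_null (E \<union> F)" if "haar_null E" "strictly_aronszajn_null F" for E F :: "'a set"
    by (rule haar_null_Un[OF that(1) strictly_aronszajn_null_imp_haar_null[OF that(2)]])
  show ?thesis
    using first on[of aronszajn_null, OF _ aronszajn_null_Un_strictly] on[of haar_null, OF _ haar]
    unfolding holds_except_null_def by blast
qed

end
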